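(* Let $R$ be a local ring (with identity), let ${}_RM$ be a finitely generated semisimple left $R$-module and let $\varphi\in\mathrm{End}_R(M)$ be nilpotent of index $n$. Let $X=\{x_{\gamma,i}\mid 1\le\gamma\le m,\ 1\le i\le k_\gamma\}$ be a nilpotent Jordan normal base of ${}_RM$ with respect to $\varphi$, with $k_1\ge k_2\ge\cdots\ge k_m\ge 1$. If $f_i(x_1,\dots,x_r)\in Z(R)\langle x_1,\dots,x_r\rangle$, $1\le i\le n$, and each $f_i=0$ is a polynomial identity of the right ideal $\mathcal{W}(X)$ of $\mathrm{M}_m^{\mathrm{op}}(R/J)$, then $f_1f_2\cdots f_n=0$ is an identity of $\mathrm{Cen}_0(\varphi)$.
   Context: $Z(R)$ and $J=J(R)$ are the centre and the Jacobson radical of $R$; $R$ is local if $R/J$ is a division ring. $Z(R)\langle x_1,\dots,x_r\rangle$ is the ring of polynomials over $Z(R)$ in non-commuting indeterminates. $\mathrm{M}_m^{\mathrm{op}}(R/J)$ is the opposite of the full $m\times m$ matrix ring over $R/J$, a $Z(R)$-algebra via $Z(R)\to R\to R/J$. "$f=0$ is an identity of $A$" means that $f(v_1,\dots,v_r)=0$ for all $v_1,\dots,v_r\in A$; evaluations (in particular of constant terms) are carried out in the unital $Z(R)$-algebras $\mathrm{M}_m^{\mathrm{op}}(R/J)$, respectively $\mathrm{End}_R(M)$. $\mathrm{Cen}_0(\varphi)=\{\psi\in\mathrm{End}_R(M)\mid\psi\circ\varphi=\varphi\circ\psi=0\}$. Nilpotent Jordan normal base: a subset $X=\{x_{\gamma,i}\mid\gamma\in\Gamma,\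 1\le i\le k_\gamma\}\subseteq M$ such that each $Rx_{\gamma,i}$ is a simple submodule, $M=\bigoplus_{\gamma\in\Gamma,\,1\le i\le k_\gamma}Rx_{\gamma,i}$ (direct sum), $\varphi(x_{\gamma,i})=x_{\gamma,i+1}$ for $1\le i<k_\gamma$, $\varphi(x_{\gamma,k_\gamma})=0$, and $\{k_\gamma\}$ is bounded. Such a base exists for any nilpotent endomorphism of a semisimple module; here $M$ is finitely generated, $\Gamma=\{1,\dots,m\}$ with $m=\dim_R(\ker\varphi)$ (the number of simple summands of $\ker\varphi$), and the nilpotency index is $n=\max_\gamma k_\gamma$. $\mathcal{W}(X)=\{W=[w_{\delta,\gamma}]\in\mathrm{M}_m(R/J)\mid w_{\delta,\gamma}=0\text{ if }k_\gamma\ge 2\}$, a left ideal of $\mathrm{M}_m(R/J)$, hence a right ideal of $\mathrm{M}_m^{\mathrm{op}}(R/J)$. *)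

theory Defs
  imports "HOL-Algebra.Algebra"
begin

definition ring_centre :: "('a, 'c) ring_scheme \<Rightarrow> 'a set" where
  "ring_centre R = {z \<in> carrier R. \<forall>a \<in> carrier R. z \<otimes>\<^bsub>R\<^esub> a = a \<otimes>\<^bsub>R\<^esub> z}"

definition centre_ring :: "('a, 'c) ring_scheme \<Rightarrow> ('a, 'c) ring_scheme" where
  "centre_ring R = R\<lparr>carrier := ring_centre R\<rparr>"

definition left_ideal :: "'a set \<Rightarrow> ('a, 'c) ring_scheme \<Rightarrow> bool" where
  "left_ideal I R \<longleftrightarrow> subgroup I (add_monoid R) \<and> (\<forall>a \<in> carrier R. \<forall>x \<in> I. a \<otimes>\<^bsub>R\<^esub> x \<in> I)"

definition maximal_left_ideal :: "'a set \<Rightarrow> ('a, 'c) ring_scheme \<Rightarrow> bool" where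
  "maximal_left_ideal I R \<longleftrightarrow> left_ideal I R \<and> I \<noteq> carrier R \<and>
     (\<forall>L. left_ideal L R \<and> I \<subseteq> L \<longrightarrow> L = I \<or> L = carrier R)"

definition jacobson_radical :: "('a, 'c) ring_scheme \<Rightarrow> 'a set" where
  "jacobson_radical R = carrier R \<inter> \<Inter>{I. maximal_left_ideal I R}"

text \<open>The zero ring is excluded: there \<open>\<zero>\<close> is a unit.\<close>
locale skew_field = ring R for R (structure) +
  assumes skew_field_Units: "Units R = carrier R - {\<zero>}"

text \<open>Not necessarily commutative.\<close>
locale local_ring = ring R for R (structure) +
  assumes residue_skew_field: "skew_field (R Quot jacobson_radical R)"

definition opposite_ring :: "('a, 'c) ring_scheme \<Rightarrow> ('a, 'c) ring_scheme" where
  "opposite_ring R = R\<lparr>monoid.mult := (\<lambda>a b. b \<otimes>\<^bsub>R\<^esub> a)\<rparr>"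

definition mat_ring :: "nat \<Rightarrow> ('a, 'c) ring_scheme \<Rightarrow> (nat \<times> nat \<Rightarrow> 'a) ring" where
  "mat_ring m S =
    \<lparr>carrier = {1..m} \<times> {1..m} \<rightarrow>\<^sub>E carrier S,
     monoid.mult = (\<lambda>A B. \<lambda>(i, j) \<in> {1..m} \<times> {1..m}. \<Oplus>\<^bsub>S\<^esub>l \<in> {1..m}. A (i, l) \<otimes>\<^bsub>S\<^esub> B (l, j)),
     one = (\<lambda>(i, j) \<in> {1..m} \<times> {1..m}. if i = j then \<one>\<^bsub>S\<^esub> else \<zero>\<^bsub>S\<^esub>),
     ring.zero = (\<lambda>(i, j) \<in> {1..m} \<times> {1..m}. \<zero>\<^bsub>S\<^esub>),
     add = (\<lambda>A B. \<lambda>(i, j) \<in> {1..m} \<times> {1..m}. A (i, j) \<oplus>\<^bsub>S\<^esub> B (i, j))\<rparr>"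

definition scalar_mat :: "nat \<Rightarrow> ('a, 'c) ring_scheme \<Rightarrow> 'a \<Rightarrow> nat \<times> nat \<Rightarrow> 'a" where
  "scalar_mat m S s = (\<lambda>(i, j) \<in> {1..m} \<times> {1..m}. if i = j then s else \<zero>\<^bsub>S\<^esub>)"

text \<open>
  A monomial \<open>x\<^sub>j\<^sub>1 \<cdots> x\<^sub>j\<^sub>l\<close> is the list of its indices, taken from \<open>{1..r}\<close>; a polynomial is
  its coefficient function on all lists of natural numbers.
\<close>
definition nc_poly :: "('a, 'c) ring_scheme \<Rightarrow> nat \<Rightarrow> (nat list \<Rightarrow> 'a) ring" where
  "nc_poly K r =
    \<lparr>carrier = {f. (\<forall>w. f w \<in> carrier K) \<and> finite {w. f w \<noteq> \<zero>\<^bsub>K\<^esub>} \<and>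
                   (\<forall>w. f w \<noteq> \<zero>\<^bsub>K\<^esub> \<longrightarrow> set w \<subseteq> {1..r})},
     monoid.mult = (\<lambda>f g w. \<Oplus>\<^bsub>K\<^esub>i \<in> {..length w}. f (take i w) \<otimes>\<^bsub>K\<^esub> g (drop i w)),
     one = (\<lambda>w. if w = [] then \<one>\<^bsub>K\<^esub> else \<zero>\<^bsub>K\<^esub>),
     ring.zero = (\<lambda>w. \<zero>\<^bsub>K\<^esub>),
     add = (\<lambda>f g w. f w \<oplus>\<^bsub>K\<^esub> g w)\<rparr>"

definition ordered_prod :: "('a, 'c) ring_scheme \<Rightarrow> 'a list \<Rightarrow> 'a" where
  "ordered_prod A as = foldr (\<lambda>a b. a \<otimes>\<^bsub>A\<^esub> b) as \<one>\<^bsub>A\<^esub>"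

text \<open>
  The \<open>K\<close>-algebra \<open>A\<close> is given by its structure map \<open>\<eta> : K \<rightarrow> A\<close>, so that a constant term \<open>c\<close>
  contributes \<open>\<eta> c\<close>.
\<close>
definition nc_eval ::
  "('a, 'c) ring_scheme \<Rightarrow> ('e, 'd) ring_scheme \<Rightarrow> ('a \<Rightarrow> 'e) \<Rightarrow> (nat list \<Rightarrow> 'a) \<Rightarrow> (nat \<Rightarrow> 'e) \<Rightarrow> 'e" where
  "nc_eval K A \<eta> f v =
     (\<Oplus>\<^bsub>A\<^esub>w \<in> {w. f w \<noteq> \<zero>\<^bsub>K\<^esub>}. \<eta> (f w) \<otimes>\<^bsub>A\<^esub> ordered_prod A (map v w))"

definition nc_identity ::
  "('a, 'c) ring_scheme \<Rightarrow> nat \<Rightarrow> ('e, 'd) ring_scheme \<Rightarrow> ('a \<Rightarrow> 'e) \<Rightarrow> 'e set \<Rightarrow> (nat list \<Rightarrow> 'a) \<Rightarrow> bool" where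
  "nc_identity K r A \<eta> S f \<longleftrightarrow>
     (\<forall>v. (\<forall>j \<in> {1..r}. v j \<in> S) \<longrightarrow> nc_eval K A \<eta> f v = \<zero>\<^bsub>A\<^esub>)"

text \<open>The library locale \<open>module\<close> requires a commutative ring of scalars.\<close>
locale left_module = R?: ring R + M?: abelian_group M
  for R :: "('a, 'c) ring_scheme" (structure) and M :: "('a, 'b, 'm) module_scheme" (structure) +
  assumes smult_closed [simp, intro]:
      "\<lbrakk>a \<in> carrier R; x \<in> carrier M\<rbrakk> \<Longrightarrow> a \<odot>\<^bsub>M\<^esub> x \<in> carrier M"
    and smult_l_distr:
      "\<lbrakk>a \<in> carrier R; b \<in> carrier R; x \<in> carrier M\<rbrakk> \<Longrightarrow>
       (a \<oplus>\<^bsub>R\<^esub> b) \<odot>\<^bsub>M\<^esub> x = a \<odot>\<^bsub>M\<^esub> x \<oplus>\<^bsub>M\<^esub> b \<odot>\<^bsub>M\<^esub> x"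
    and smult_r_distr:
      "\<lbrakk>a \<in> carrier R; x \<in> carrier M; y \<in> carrier M\<rbrakk> \<Longrightarrow>
       a \<odot>\<^bsub>M\<^esub> (x \<oplus>\<^bsub>M\<^esub> y) = a \<odot>\<^bsub>M\<^esub> x \<oplus>\<^bsub>M\<^esub> a \<odot>\<^bsub>M\<^esub> y"
    and smult_assoc1:
      "\<lbrakk>a \<in> carrier R; b \<in> carrier R; x \<in> carrier M\<rbrakk> \<Longrightarrow>
       (a \<otimes>\<^bsub>R\<^esub> b) \<odot>\<^bsub>M\<^esub> x = a \<odot>\<^bsub>M\<^esub> (b \<odot>\<^bsub>M\<^esub> x)"
    and smult_one [simp]: "x \<in> carrier M \<Longrightarrow> \<one>\<^bsub>R\<^esub> \<odot>\<^bsub>M\<^esub> x = x"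

definition cyclic_submodule ::
  "('a, 'c) ring_scheme \<Rightarrow> ('a, 'b, 'm) module_scheme \<Rightarrow> 'b \<Rightarrow> 'b set" where
  "cyclic_submodule R M x = (\<lambda>a. a \<odot>\<^bsub>M\<^esub> x) ` carrier R"

definition simple_submodule ::
  "'b set \<Rightarrow> ('a, 'c) ring_scheme \<Rightarrow> ('a, 'b, 'm) module_scheme \<Rightarrow> bool" where
  "simple_submodule N R M \<longleftrightarrow> submodule N R M \<and> N \<noteq> {\<zero>\<^bsub>M\<^esub>} \<and>
     (\<forall>L. submodule L R M \<and> L \<subseteq> N \<longrightarrow> L = {\<zero>\<^bsub>M\<^esub>} \<or> L = N)"

definition finitely_generated_module ::
  "('a, 'c) ring_scheme \<Rightarrow> ('a, 'b, 'm) module_scheme \<Rightarrow> bool" where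
  "finitely_generated_module R M \<longleftrightarrow>
     (\<exists>A. finite A \<and> A \<subseteq> carrier M \<and> (\<forall>N. submodule N R M \<and> A \<subseteq> N \<longrightarrow> N = carrier M))"

text \<open>
  The sum is taken over the support of \<open>c\<close> because \<open>finsum\<close> is \<open>\<zero>\<close> on every infinite index set.
\<close>
definition internal_direct_sum ::
  "('a, 'c) ring_scheme \<Rightarrow> ('a, 'b, 'm) module_scheme \<Rightarrow> 'i set \<Rightarrow> ('i \<Rightarrow> 'b set) \<Rightarrow> bool" where
  "internal_direct_sum R M I N \<longleftrightarrow>
     (\<forall>i \<in> I. submodule (N i) R M) \<and>
     (\<forall>x \<in> carrier M. \<exists>!c. c \<in> (\<Pi>\<^sub>E i \<in> I. N i) \<and> finite {i \<in> I. c i \<noteq> \<zero>\<^bsub>M\<^esub>} \<and>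
        x = (\<Oplus>\<^bsub>M\<^esub>i \<in> {i \<in> I. c i \<noteq> \<zero>\<^bsub>M\<^esub>}. c i))"

definition semisimple_module ::
  "('a, 'c) ring_scheme \<Rightarrow> ('a, 'b, 'm) module_scheme \<Rightarrow> bool" where
  "semisimple_module R M \<longleftrightarrow>
     (\<exists>\<N>. (\<forall>N \<in> \<N>. simple_submodule N R M) \<and> internal_direct_sum R M \<N> (\<lambda>N. N))"

text \<open>Endomorphisms are extensional functions on the carrier, so that equality is that of maps.\<close>
definition End_ring ::
  "('a, 'c) ring_scheme \<Rightarrow> ('a, 'b, 'm) module_scheme \<Rightarrow> ('b \<Rightarrow> 'b) ring" where
  "End_ring R M =
    \<lparr>carrier = {\<psi> \<in> carrier M \<rightarrow>\<^sub>E carrier M.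
        (\<forall>x \<in> carrier M. \<forall>y \<in> carrier M. \<psi> (x \<oplus>\<^bsub>M\<^esub> y) = \<psi> x \<oplus>\<^bsub>M\<^esub> \<psi> y) \<and>
        (\<forall>a \<in> carrier R. \<forall>x \<in> carrier M. \<psi> (a \<odot>\<^bsub>M\<^esub> x) = a \<odot>\<^bsub>M\<^esub> \<psi> x)},
     monoid.mult = (\<lambda>\<psi> \<chi>. compose (carrier M) \<psi> \<chi>),
     one = (\<lambda>x \<in> carrier M. x),
     ring.zero = (\<lambda>x \<in> carrier M. \<zero>\<^bsub>M\<^esub>),
     add = (\<lambda>\<psi> \<chi>. \<lambda>x \<in> carrier M. \<psi> x \<oplus>\<^bsub>M\<^esub> \<chi> x)\<rparr>"

definition scalar_endo :: "('a, 'b, 'm) module_scheme \<Rightarrow> 'a \<Rightarrow> 'b \<Rightarrow> 'b" where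
  "scalar_endo M a = (\<lambda>x \<in> carrier M. a \<odot>\<^bsub>M\<^esub> x)"

text \<open>Index \<open>0\<close> occurs exactly when \<open>\<one> = \<zero>\<close>, i.e. for endomorphisms of the zero module.\<close>
definition nilpotent_of_index :: "('a, 'c) ring_scheme \<Rightarrow> 'a \<Rightarrow> nat \<Rightarrow> bool" where
  "nilpotent_of_index A a n \<longleftrightarrow> a [^]\<^bsub>A\<^esub> n = \<zero>\<^bsub>A\<^esub> \<and> (\<forall>l < n. a [^]\<^bsub>A\<^esub> l \<noteq> \<zero>\<^bsub>A\<^esub>)"

definition Cen0 ::
  "('a, 'c) ring_scheme \<Rightarrow> ('a, 'b, 'm) module_scheme \<Rightarrow> ('b \<Rightarrow> 'b) \<Rightarrow> ('b \<Rightarrow> 'b) set" where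
  "Cen0 R M \<phi> = {\<psi> \<in> carrier (End_ring R M).
     \<psi> \<otimes>\<^bsub>End_ring R M\<^esub> \<phi> = \<zero>\<^bsub>End_ring R M\<^esub> \<and> \<phi> \<otimes>\<^bsub>End_ring R M\<^esub> \<psi> = \<zero>\<^bsub>End_ring R M\<^esub>}"

text \<open>
  The base is the doubly indexed family \<open>x \<gamma> i\<close>; values of \<open>x\<close> outside the index set
  \<open>{(\<gamma>, i). \<gamma> \<in> \<Gamma>, 1 \<le> i \<le> k \<gamma>}\<close> are irrelevant.
\<close>
definition nilpotent_jordan_base ::
  "('a, 'c) ring_scheme \<Rightarrow> ('a, 'b, 'm) module_scheme \<Rightarrow> ('b \<Rightarrow> 'b) \<Rightarrow>
   'g set \<Rightarrow> ('g \<Rightarrow> nat) \<Rightarrow> ('g \<Rightarrow> nat \<Rightarrow> 'b) \<Rightarrow> bool" where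
  "nilpotent_jordan_base R M \<phi> \<Gamma> k x \<longleftrightarrow>
     (\<forall>\<gamma> \<in> \<Gamma>. 1 \<le> k \<gamma>) \<and>
     (\<forall>\<gamma> \<in> \<Gamma>. \<forall>i \<in> {1..k \<gamma>}. x \<gamma> i \<in> carrier M \<and> simple_submodule (cyclic_submodule R M (x \<gamma> i)) R M) \<and>
     internal_direct_sum R M (SIGMA \<gamma>:\<Gamma>. {1..k \<gamma>}) (\<lambda>(\<gamma>, i). cyclic_submodule R M (x \<gamma> i)) \<and>
     (\<forall>\<gamma> \<in> \<Gamma>. \<forall>i. 1 \<le> i \<and> i < k \<gamma> \<longrightarrow> \<phi> (x \<gamma> i) = x \<gamma> (i + 1)) \<and>
     (\<forall>\<gamma> \<in> \<Gamma>. \<phi> (x \<gamma> (k \<gamma>)) = \<zero>\<^bsub>M\<^esub>) \<and>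
     (\<exists>B. \<forall>\<gamma> \<in> \<Gamma>. k \<gamma> \<le> B)"

definition W_ideal :: "nat \<Rightarrow> ('a, 'c) ring_scheme \<Rightarrow> (nat \<Rightarrow> nat) \<Rightarrow> (nat \<times> nat \<Rightarrow> 'a) set" where
  "W_ideal m S k = {W \<in> carrier (mat_ring m S).
     \<forall>\<delta> \<in> {1..m}. \<forall>\<gamma> \<in> {1..m}. 2 \<le> k \<gamma> \<longrightarrow> W (\<delta>, \<gamma>) = \<zero>\<^bsub>S\<^esub>}"

end

theory Submission
  imports Defs
begin

text \<open>
  Write \<open>S = R/J\<close>. Over a local ring the annihilator of a generator of a simple module is exactly
  \<open>J\<close> (\<open>annihilator_simple_eq_jacobson_radical\<close>), so every element of \<open>M\<close> has well defined
  coordinates in \<open>S\<close> with respect to the Jordan base. Call \<open>x\<^sub>\<gamma>\<^sub>,\<^sub>1\<close> the head of the chain \<open>\<gamma>\<close>.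

  An endomorphism \<open>\<psi>\<close> in \<open>Cen\<^sub>0(\<phi>)\<close> vanishes on the image of \<open>\<phi>\<close>, that is, on every base element
  except the heads, and its values lie in the kernel of \<open>\<phi>\<close>. An element of that kernel has no
  coordinate at the head of a chain of length at least 2 (\<open>coord_ker_phi\<close>). So when a second member
  of \<open>Cen\<^sub>0(\<phi>)\<close> is applied after \<open>\<psi>\<close>, it sees only the coordinates of \<open>\<psi>(x\<^sub>\<delta>\<^sub>,\<^sub>1)\<close> at the heads of
  the chains of length 1. Collect these in the matrix \<open>rep \<psi>\<close>; it belongs to \<open>\<W>(X)\<close>, and
  \<open>\<psi> \<mapsto> rep \<psi>\<close> is additive and multiplicative from \<open>Cen\<^sub>0(\<phi>)\<close> into the opposite matrix ring
  (\<open>rep_mult\<close>).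

  Let \<open>f = 0\<close> be an identity of \<open>\<W>(X)\<close>. Evaluation at zero puts the constant term of \<open>f\<close> into \<open>J\<close>
  (\<open>constant_term_in_jacobson_radical\<close>), and \<open>J\<close> annihilates \<open>M\<close>. Hence a value \<open>\<psi>\<close> of \<open>f\<close> on
  \<open>Cen\<^sub>0(\<phi>)\<close> stays in \<open>Cen\<^sub>0(\<phi>)\<close>, and \<open>rep \<psi>\<close> is the value of \<open>f\<close> at the representing matrices
  (\<open>rep_nc_eval\<close>), namely \<open>0\<close>. But then \<open>\<psi>\<close> maps into the span of the base elements other than
  heads, which is killed by all of \<open>Cen\<^sub>0(\<phi>)\<close>: \<open>\<chi> \<psi> = 0\<close> for every \<open>\<chi>\<close> in \<open>Cen\<^sub>0(\<phi>)\<close>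
  (\<open>mult_eq_zero_of_rep_zero\<close>). If \<open>n \<ge> 2\<close>, this annihilates the product of the values of \<open>f\<^sub>1\<close> and
  \<open>f\<^sub>2\<close>. If \<open>n = 1\<close>, then \<open>\<phi> = 0\<close>, the identity map lies in \<open>Cen\<^sub>0(\<phi>)\<close> and can be taken as \<open>\<chi>\<close>;
  if \<open>n = 0\<close>, then \<open>M = 0\<close>. That the value of a product is the product of the values is
  \<open>nc_eval_ordered_prod\<close>.
\<close>

section \<open>The Jacobson radical\<close>

lemma Quot_carrierE:
  assumes "B \<in> carrier (R Quot I)"
  obtains b where "b \<in> carrier R" "B = I +>\<^bsub>R\<^esub> b"
  using assms by (auto simp: FactRing_def A_RCOSETS_def' a_r_coset_def')

lemma left_idealD:
  assumes "left_ideal I R"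
  shows "I \<subseteq> carrier R" and "\<zero>\<^bsub>R\<^esub> \<in> I"
    and "\<And>a b. a \<in> I \<Longrightarrow> b \<in> I \<Longrightarrow> a \<oplus>\<^bsub>R\<^esub> b \<in> I"
    and "\<And>a b. a \<in> carrier R \<Longrightarrow> b \<in> I \<Longrightarrow> a \<otimes>\<^bsub>R\<^esub> b \<in> I"
  using assms subgroup.subset[of I "add_monoid R"] subgroup.one_closed[of I "add_monoid R"]
    subgroup.m_closed[of I "add_monoid R"]
  by (auto simp: left_ideal_def)

context ring
begin

lemma left_idealI:
  assumes "I \<subseteq> carrier R" and "\<zero> \<in> I" and "\<And>a b. a \<in> I \<Longrightarrow> b \<in> I \<Longrightarrow> a \<oplus> b \<in> I"
    and mult: "\<And>a b. a \<in> carrier R \<Longrightarrow> b \<in> I \<Longrightarrow> a \<otimes> b \<in> I"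
  shows "left_ideal I R"
proof -
  have "\<ominus> b \<in> I" if "b \<in> I" for b
    using mult[of "\<ominus> \<one>" b] that assms(1) by (auto simp: l_minus)
  then have "subgroup I (add_monoid R)"
    using assms by (intro add.subgroupI) auto
  then show ?thesis
    using mult by (auto simp: left_ideal_def)
qed

lemma left_ideal_eq_carrier:
  assumes "left_ideal I R" "\<one> \<in> I"
  shows "I = carrier R"
  using left_idealD(1)[OF assms(1)] left_idealD(4)[OF assms(1) _ assms(2)] by force

text \<open>
  In terms of the simple module \<open>R/I\<close>: the preimage is the annihilator of the class of \<open>r\<close>, and
  every nonzero element of a simple module has a maximal annihilator.
\<close>
lemma maximal_left_ideal_preimage:
  assumes I: "maximal_left_ideal I R" and r: "r \<in> carrier R" "r \<notin> I"
  shows "maximal_left_ideal {a \<in> carrier R. a \<otimes> r \<in> I} R" (is "maximal_left_ideal ?K R")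
proof -
  have lI: "left_ideal I R" using I by (simp add: maximal_left_ideal_def)
  note ID = left_idealD[OF lI]
  have "left_ideal ?K R"
    using ID r by (intro left_idealI) (auto simp: l_distr m_assoc)
  moreover have "\<one> \<notin> ?K" using r by simp
  moreover have "L = carrier R" if L: "left_ideal L R" "?K \<subseteq> L" "L \<noteq> ?K" for L
  proof -
    note LD = left_idealD[OF L(1)]
    obtain l where l: "l \<in> L" "l \<otimes> r \<notin> I" using L LD(1) by blast
    define N where "N = {i \<oplus> b \<otimes> r | i b. i \<in> I \<and> b \<in> L}"
    have "left_ideal N R"
    proof (rule left_idealI)
      show "N \<subseteq> carrier R" using ID(1) LD(1) r by (auto simp: N_def)
      have "\<zero> = \<zero> \<oplus> \<zero> \<otimes> r" using r by simp
      then show "\<zero> \<in> N" unfolding N_def using ID(2) LD(2) by blast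
    next
      fix u v assume "u \<in> N" "v \<in> N"
      then obtain i b j c where uv: "i \<in> I" "b \<in> L" "u = i \<oplus> b \<otimes> r" "j \<in> I" "c \<in> L" "v = j \<oplus> c \<otimes> r"
        by (auto simp: N_def)
      then have "u \<oplus> v = (i \<oplus> j) \<oplus> (b \<oplus> c) \<otimes> r"
        using ID(1) LD(1) r by (auto simp: l_distr a_ac subset_eq)
      then show "u \<oplus> v \<in> N" unfolding N_def using uv ID(3) LD(3) by blast
    next
      fix a u assume a: "a \<in> carrier R" "u \<in> N"
      then obtain i b where u: "i \<in> I" "b \<in> L" "u = i \<oplus> b \<otimes> r" by (auto simp: N_def)
      then have "a \<otimes> u = (a \<otimes> i) \<oplus> (a \<otimes> b) \<otimes> r"
        using a ID(1) LD(1) r by (auto simp: r_distr m_assoc subset_eq)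
      then show "a \<otimes> u \<in> N" unfolding N_def using u a ID(4) LD(4) by blast
    qed
    moreover have "I \<subseteq> N"
    proof
      fix i assume i: "i \<in> I"
      then have "i = i \<oplus> \<zero> \<otimes> r" using r ID(1) by auto
      then show "i \<in> N" unfolding N_def using i LD(2) by blast
    qed
    moreover have "l \<otimes> r = \<zero> \<oplus> l \<otimes> r" using l r LD(1) by auto
    then have "l \<otimes> r \<in> N" unfolding N_def using l ID(2) by blast
    ultimately have "N = carrier R" using I l unfolding maximal_left_ideal_def by blast
    then have "r \<in> N" using r by simp
    then obtain i b where ib: "i \<in> I" "b \<in> L" "r = i \<oplus> b \<otimes> r" unfolding N_def by blast
    have cl: "i \<in> carrier R" "b \<in> carrier R" using ib ID(1) LD(1) by auto
    have "(\<one> \<ominus> b) \<otimes> r = r \<ominus> b \<otimes> r"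
      using cl r by (simp add: a_minus_def l_distr l_minus)
    also have "\<dots> = i \<oplus> b \<otimes> r \<ominus> b \<otimes> r" using ib(3) by simp
    also have "\<dots> = i" using cl r by (simp add: a_minus_def a_assoc r_neg)
    finally have "\<one> \<ominus> b \<in> ?K" using cl ib by simp
    then have "\<one> \<ominus> b \<oplus> b \<in> L" using L(2) ib LD(3) by blast
    moreover have "\<one> \<ominus> b \<oplus> b = \<one>" using cl by (simp add: a_minus_def a_assoc l_neg)
    ultimately show ?thesis using left_ideal_eq_carrier[OF L(1)] by simp
  qed
  ultimately show ?thesis unfolding maximal_left_ideal_def by blast
qed

text \<open>
  Only closure under right multiplication is in question: \<open>j r\<close> lies in a maximal left ideal \<open>I\<close>
  because \<open>j\<close> lies in the preimage of \<open>I\<close> under right multiplication by \<open>r\<close>, which is again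
  maximal unless \<open>r \<in> I\<close>.
\<close>
lemma jacobson_radical_ideal: "ideal (jacobson_radical R) R"
proof -
  let ?J = "jacobson_radical R"
  have l: "left_ideal ?J R"
    by (rule left_idealI) (auto simp: jacobson_radical_def maximal_left_ideal_def dest: left_idealD)
  show ?thesis
  proof (rule idealI)
    show "ring R" by (rule ring_axioms)
    show "subgroup ?J (add_monoid R)" using l by (simp add: left_ideal_def)
    show "r \<otimes> j \<in> ?J" if "j \<in> ?J" "r \<in> carrier R" for j r
      using left_idealD(4)[OF l] that by blast
    show "j \<otimes> r \<in> ?J" if j: "j \<in> ?J" and r: "r \<in> carrier R" for j r
    proof -
      have jR: "j \<in> carrier R" using j by (simp add: jacobson_radical_def)
      have "j \<otimes> r \<in> I" if I: "maximal_left_ideal I R" for I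
      proof (cases "r \<in> I")
        case True
        then show ?thesis using I jR by (auto simp: maximal_left_ideal_def dest: left_idealD(4))
      next
        case False
        then show ?thesis
          using maximal_left_ideal_preimage[OF I r] j by (auto simp: jacobson_radical_def)
      qed
      then show ?thesis using jR r by (simp add: jacobson_radical_def)
    qed
  qed
qed

end

text \<open>
  The division ring hypothesis makes \<open>J\<close> itself a maximal left ideal: a left ideal that contains
  \<open>J\<close> and a further element contains a unit modulo \<open>J\<close>.
\<close>
lemma (in local_ring) left_ideal_eq_jacobson_radical:
  assumes L: "left_ideal L R" "\<one> \<notin> L" and sub: "jacobson_radical R \<subseteq> L"
  shows "L = jacobson_radical R"
proof -
  let ?J = "jacobson_radical R"
  let ?S = "R Quot ?J"
  interpret J: ideal ?J R by (rule jacobson_radical_ideal)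
  interpret h: ring_hom_ring R ?S "(+>) ?J" by (rule J.rcos_ring_hom_ring)
  note LD = left_idealD[OF L(1)]
  have "a \<in> ?J" if a: "a \<in> L" for a
  proof (rule ccontr)
    assume nJ: "a \<notin> ?J"
    have aR: "a \<in> carrier R" using a LD(1) by auto
    have "\<zero>\<^bsub>?S\<^esub> = ?J" by (simp only: FactRing_def ring.simps)
    then have "?J +> a \<noteq> \<zero>\<^bsub>?S\<^esub>" using J.rcos_const_imp_mem[OF aR] nJ by metis
    then have "?J +> a \<in> Units ?S"
      using skew_field.skew_field_Units[OF residue_skew_field] h.hom_closed[OF aR] by blast
    then obtain B where B: "B \<in> carrier ?S" "B \<otimes>\<^bsub>?S\<^esub> (?J +> a) = \<one>\<^bsub>?S\<^esub>"
      by (auto simp: Units_def)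
    obtain b where b: "b \<in> carrier R" "B = ?J +> b"
      using B(1) by (rule Quot_carrierE)
    have "?J +> (b \<otimes> a) = ?J +> \<one>"
      using B(2) h.hom_mult[OF b(1) aR] h.hom_one unfolding b(2) by metis
    then have "\<one> \<in> ?J +> (b \<otimes> a)"
      using J.a_rcos_self[OF one_closed] by metis
    then obtain j where j: "j \<in> ?J" "\<one> = j \<oplus> b \<otimes> a"
      by (auto simp: a_r_coset_def')
    have "j \<oplus> b \<otimes> a \<in> L" using LD(3)[of j "b \<otimes> a"] LD(4)[of b a] j(1) sub a b(1) by blast
    then have "\<one> \<in> L" using j(2) by simp
    then show False using L by simp
  qed
  then show ?thesis using sub by blast
qed

section \<open>Left modules\<close>

context left_module
begin

lemma smult_zero [simp]: "a \<in> carrier R \<Longrightarrow> a \<odot>\<^bsub>M\<^esub> \<zero>\<^bsub>M\<^esub> = \<zero>\<^bsub>M\<^esub>"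
  using smult_r_distr[of a "\<zero>\<^bsub>M\<^esub>" "\<zero>\<^bsub>M\<^esub>"] by (metis M.add.l_cancel_one' M.l_zero M.zero_closed smult_closed)

lemma zero_smult [simp]: "y \<in> carrier M \<Longrightarrow> \<zero>\<^bsub>R\<^esub> \<odot>\<^bsub>M\<^esub> y = \<zero>\<^bsub>M\<^esub>"
  using smult_l_distr[of "\<zero>\<^bsub>R\<^esub>" "\<zero>\<^bsub>R\<^esub>" y] by (metis M.add.l_cancel_one' R.l_zero R.zero_closed smult_closed)

lemma smult_minus:
  assumes "a \<in> carrier R" "y \<in> carrier M"
  shows "(\<ominus>\<^bsub>R\<^esub> a) \<odot>\<^bsub>M\<^esub> y = \<ominus>\<^bsub>M\<^esub> (a \<odot>\<^bsub>M\<^esub> y)"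
  using smult_l_distr[of "\<ominus>\<^bsub>R\<^esub> a" a y] assms by (simp add: M.minus_equality R.l_neg)

lemma cyclic_submodule_image:
  assumes L: "left_ideal L R" and y: "y \<in> carrier M"
  shows "submodule ((\<lambda>a. a \<odot>\<^bsub>M\<^esub> y) ` L) R M"
proof -
  note LD = left_idealD[OF L]
  have "\<ominus>\<^bsub>M\<^esub> (a \<odot>\<^bsub>M\<^esub> y) \<in> (\<lambda>a. a \<odot>\<^bsub>M\<^esub> y) ` L" if "a \<in> L" for a
  proof -
    have "\<ominus>\<^bsub>R\<^esub> a \<in> L"
      using LD(4)[of "\<ominus>\<^bsub>R\<^esub> \<one>\<^bsub>R\<^esub>" a] LD(1) that by (auto simp: R.l_minus)
    then show ?thesis using smult_minus[of a y] LD(1) that y by (metis imageI subsetD)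
  qed
  moreover have "a \<odot>\<^bsub>M\<^esub> y \<oplus>\<^bsub>M\<^esub> b \<odot>\<^bsub>M\<^esub> y \<in> (\<lambda>a. a \<odot>\<^bsub>M\<^esub> y) ` L" if "a \<in> L" "b \<in> L" for a b
    using smult_l_distr[of a b y] LD(1,3) that y by (metis imageI subsetD)
  moreover have "a \<odot>\<^bsub>M\<^esub> (b \<odot>\<^bsub>M\<^esub> y) \<in> (\<lambda>a. a \<odot>\<^bsub>M\<^esub> y) ` L" if "a \<in> carrier R" "b \<in> L" for a b
    using smult_assoc1[of a b y] LD(1,4) that y by (metis imageI subsetD)
  moreover have "\<zero>\<^bsub>M\<^esub> \<in> (\<lambda>a. a \<odot>\<^bsub>M\<^esub> y) ` L"
    using LD(2) y by (intro image_eqI[of _ _ "\<zero>\<^bsub>R\<^esub>"]) auto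
  ultimately show ?thesis
    using LD(1) y
    by (intro submodule.intro subgroup.intro submodule_axioms.intro) (auto simp flip: a_inv_def)
qed

text \<open>
  The annihilator of a generator of a simple module is a maximal left ideal, so it contains \<open>J\<close>,
  and over a local ring nothing but \<open>J\<close> is left for it.
\<close>
lemma annihilator_simple_eq_jacobson_radical:
  assumes "local_ring R" and y: "y \<in> carrier M"
    and simple: "simple_submodule (cyclic_submodule R M y) R M"
  shows "{a \<in> carrier R. a \<odot>\<^bsub>M\<^esub> y = \<zero>\<^bsub>M\<^esub>} = jacobson_radical R" (is "?A = _")
proof -
  interpret local_ring R by fact
  have lA: "left_ideal ?A R"
    using y by (intro R.left_idealI) (auto simp: smult_l_distr smult_assoc1)
  have nz: "y \<noteq> \<zero>\<^bsub>M\<^esub>"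
  proof
    assume "y = \<zero>\<^bsub>M\<^esub>"
    then have "cyclic_submodule R M y = {\<zero>\<^bsub>M\<^esub>}"
      unfolding cyclic_submodule_def using R.zero_closed by (auto intro: image_eqI[of _ _ "\<zero>\<^bsub>R\<^esub>"])
    then show False using simple unfolding simple_submodule_def by blast
  qed
  have "L = carrier R" if L: "left_ideal L R" "?A \<subseteq> L" "L \<noteq> ?A" for L
  proof -
    note LD = left_idealD[OF L(1)]
    obtain l where l: "l \<in> L" "l \<odot>\<^bsub>M\<^esub> y \<noteq> \<zero>\<^bsub>M\<^esub>" using L LD(1) by blast
    let ?N = "(\<lambda>a. a \<odot>\<^bsub>M\<^esub> y) ` L"
    have "?N \<subseteq> cyclic_submodule R M y" using LD(1) by (auto simp: cyclic_submodule_def)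
    moreover have "?N \<noteq> {\<zero>\<^bsub>M\<^esub>}" using l by blast
    ultimately have "?N = cyclic_submodule R M y"
      using simple cyclic_submodule_image[OF L(1) y] unfolding simple_submodule_def by blast
    then have "\<one>\<^bsub>R\<^esub> \<odot>\<^bsub>M\<^esub> y \<in> ?N" unfolding cyclic_submodule_def using R.one_closed by blast
    then obtain b where b: "b \<in> L" "b \<odot>\<^bsub>M\<^esub> y = y" using y by auto
    have bR: "b \<in> carrier R" using b LD(1) by auto
    have "(\<one>\<^bsub>R\<^esub> \<ominus>\<^bsub>R\<^esub> b) \<odot>\<^bsub>M\<^esub> y = y \<oplus>\<^bsub>M\<^esub> \<ominus>\<^bsub>M\<^esub> (b \<odot>\<^bsub>M\<^esub> y)"
      using bR y by (simp add: R.minus_eq smult_l_distr smult_minus)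
    also have "\<dots> = \<zero>\<^bsub>M\<^esub>" using b(2) y by (simp add: M.r_neg)
    finally have "\<one>\<^bsub>R\<^esub> \<ominus>\<^bsub>R\<^esub> b \<in> L" using L(2) bR by auto
    then have "\<one>\<^bsub>R\<^esub> \<ominus>\<^bsub>R\<^esub> b \<oplus>\<^bsub>R\<^esub> b \<in> L" using b LD(3) by blast
    moreover have "\<one>\<^bsub>R\<^esub> \<ominus>\<^bsub>R\<^esub> b \<oplus>\<^bsub>R\<^esub> b = \<one>\<^bsub>R\<^esub>"
      using bR by (simp add: R.minus_eq R.a_assoc R.l_neg)
    ultimately show ?thesis using R.left_ideal_eq_carrier[OF L(1)] by simp
  qed
  moreover have "\<one>\<^bsub>R\<^esub> \<notin> ?A" using nz y by simp
  ultimately have "maximal_left_ideal ?A R"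
    using lA unfolding maximal_left_ideal_def by blast
  then have "jacobson_radical R \<subseteq> ?A" unfolding jacobson_radical_def by blast
  then show ?thesis
    using left_ideal_eq_jacobson_radical[OF lA \<open>\<one>\<^bsub>R\<^esub> \<notin> ?A\<close>] by simp
qed

end

section \<open>Finite sums\<close>

lemma finsum_hom:
  assumes "abelian_monoid G" "abelian_monoid H"
    and h: "h \<in> carrier G \<rightarrow> carrier H" "h \<zero>\<^bsub>G\<^esub> = \<zero>\<^bsub>H\<^esub>"
      "\<And>a b. a \<in> carrier G \<Longrightarrow> b \<in> carrier G \<Longrightarrow> h (a \<oplus>\<^bsub>G\<^esub> b) = h a \<oplus>\<^bsub>H\<^esub> h b"
    and "g \<in> F \<rightarrow> carrier G"
  shows "h (finsum G g F) = finsum H (\<lambda>i. h (g i)) F"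
proof -
  interpret G: abelian_monoid G by fact
  interpret H: abelian_monoid H by fact
  show ?thesis
    using assms(6)
  proof (induction F rule: infinite_finite_induct)
    case (insert i F)
    then have "g i \<in> carrier G" "g \<in> F \<rightarrow> carrier G" by auto
    then show ?case
      using insert h(1) by (simp add: Pi_iff h(3))
  qed (simp_all add: h(2))
qed

lemma (in abelian_monoid) finsum_mono_neutral:
  assumes "finite F" "E \<subseteq> F" "\<And>i. i \<in> F - E \<Longrightarrow> g i = \<zero>" "g \<in> F \<rightarrow> carrier G"
  shows "finsum G g E = finsum G g F"
  unfolding finsum_def
  by (rule comm_monoid.finprod_mono_neutral_cong_left[OF a_comm_monoid]) (use assms in auto)

lemma (in abelian_monoid) finsum_eq_single:
  assumes "finite F" "i \<in> F" "\<And>j. j \<in> F \<Longrightarrow> j \<noteq> i \<Longrightarrow> g j = \<zero>" "g i \<in> carrier G"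
  shows "finsum G g F = g i"
proof -
  have "finsum G g {i} = finsum G g F"
  proof (rule finsum_mono_neutral)
    show "g \<in> F \<rightarrow> carrier G" using assms(3,4) by (metis Pi_I zero_closed)
  qed (use assms in auto)
  then show ?thesis using assms by (simp add: Pi_iff)
qed

lemma (in abelian_monoid) finsum_UN_disjoint:
  assumes "finite I" "\<And>i. i \<in> I \<Longrightarrow> finite (A i)"
    and "\<And>i j. i \<in> I \<Longrightarrow> j \<in> I \<Longrightarrow> i \<noteq> j \<Longrightarrow> A i \<inter> A j = {}"
    and "\<And>i x. i \<in> I \<Longrightarrow> x \<in> A i \<Longrightarrow> g x \<in> carrier G"
  shows "finsum G g (\<Union>(A ` I)) = (\<Oplus>i\<in>I. finsum G g (A i))"
  unfolding finsum_def
  by (rule comm_monoid.finprod_UN_disjoint[OF a_comm_monoid])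
     (use assms in \<open>auto simp: pairwise_def disjnt_def\<close>)

section \<open>The endomorphism ring\<close>

lemma End_ring_carrierD:
  assumes "\<psi> \<in> carrier (End_ring R M)"
  shows "y \<in> carrier M \<Longrightarrow> \<psi> y \<in> carrier M"
    and "y \<in> carrier M \<Longrightarrow> z \<in> carrier M \<Longrightarrow> \<psi> (y \<oplus>\<^bsub>M\<^esub> z) = \<psi> y \<oplus>\<^bsub>M\<^esub> \<psi> z"
    and "a \<in> carrier R \<Longrightarrow> y \<in> carrier M \<Longrightarrow> \<psi> (a \<odot>\<^bsub>M\<^esub> y) = a \<odot>\<^bsub>M\<^esub> \<psi> y"
    and "\<psi> \<in> extensional (carrier M)"
  using assms by (auto simp: End_ring_def PiE_def)

lemma End_ring_apply [simp]:
  "y \<in> carrier M \<Longrightarrow> (\<psi> \<otimes>\<^bsub>End_ring R M\<^esub> \<chi>) y = \<psi> (\<chi> y)"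
  "y \<in> carrier M \<Longrightarrow> (\<psi> \<oplus>\<^bsub>End_ring R M\<^esub> \<chi>) y = \<psi> y \<oplus>\<^bsub>M\<^esub> \<chi> y"
  "y \<in> carrier M \<Longrightarrow> \<one>\<^bsub>End_ring R M\<^esub> y = y"
  "y \<in> carrier M \<Longrightarrow> \<zero>\<^bsub>End_ring R M\<^esub> y = \<zero>\<^bsub>M\<^esub>"
  "y \<in> carrier M \<Longrightarrow> scalar_endo M a y = a \<odot>\<^bsub>M\<^esub> y"
  by (simp_all add: End_ring_def compose_eq scalar_endo_def)

lemma End_ring_ext:
  assumes "\<psi> \<in> carrier (End_ring R M)" "\<chi> \<in> carrier (End_ring R M)"
    and "\<And>y. y \<in> carrier M \<Longrightarrow> \<psi> y = \<chi> y"
  shows "\<psi> = \<chi>"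
  using extensionalityI[OF End_ring_carrierD(4)[OF assms(1)] End_ring_carrierD(4)[OF assms(2)]] assms(3)
  by blast

context left_module
begin

lemma End_ring_carrierI:
  assumes "\<psi> \<in> extensional (carrier M)" "\<And>y. y \<in> carrier M \<Longrightarrow> \<psi> y \<in> carrier M"
    and "\<And>y z. y \<in> carrier M \<Longrightarrow> z \<in> carrier M \<Longrightarrow> \<psi> (y \<oplus>\<^bsub>M\<^esub> z) = \<psi> y \<oplus>\<^bsub>M\<^esub> \<psi> z"
    and "\<And>a y. a \<in> carrier R \<Longrightarrow> y \<in> carrier M \<Longrightarrow> \<psi> (a \<odot>\<^bsub>M\<^esub> y) = a \<odot>\<^bsub>M\<^esub> \<psi> y"
  shows "\<psi> \<in> carrier (End_ring R M)"
  using assms by (auto simp: End_ring_def PiE_def)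

lemma End_ring_extensional:
  "\<psi> \<otimes>\<^bsub>End_ring R M\<^esub> \<chi> \<in> extensional (carrier M)"
  "\<psi> \<oplus>\<^bsub>End_ring R M\<^esub> \<chi> \<in> extensional (carrier M)"
  "\<one>\<^bsub>End_ring R M\<^esub> \<in> extensional (carrier M)"
  "\<zero>\<^bsub>End_ring R M\<^esub> \<in> extensional (carrier M)"
  "scalar_endo M a \<in> extensional (carrier M)"
  by (simp_all add: End_ring_def compose_def scalar_endo_def)

lemma End_ring_closed:
  assumes "\<psi> \<in> carrier (End_ring R M)" "\<chi> \<in> carrier (End_ring R M)"
  shows "\<psi> \<otimes>\<^bsub>End_ring R M\<^esub> \<chi> \<in> carrier (End_ring R M)"
    and "\<psi> \<oplus>\<^bsub>End_ring R M\<^esub> \<chi> \<in> carrier (End_ring R M)"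
  using End_ring_carrierD(1-3)[OF assms(1)] End_ring_carrierD(1-3)[OF assms(2)]
  by (auto intro!: End_ring_carrierI simp: End_ring_extensional smult_r_distr M.a_ac)

lemma End_ring_const_closed:
  "\<one>\<^bsub>End_ring R M\<^esub> \<in> carrier (End_ring R M)" "\<zero>\<^bsub>End_ring R M\<^esub> \<in> carrier (End_ring R M)"
  by (auto intro!: End_ring_carrierI simp: End_ring_extensional)

lemma End_apply_zero [simp]:
  assumes "\<psi> \<in> carrier (End_ring R M)"
  shows "\<psi> \<zero>\<^bsub>M\<^esub> = \<zero>\<^bsub>M\<^esub>"
  using End_ring_carrierD(3)[OF assms, of "\<zero>\<^bsub>R\<^esub>" "\<zero>\<^bsub>M\<^esub>"] End_ring_carrierD(1)[OF assms, of "\<zero>\<^bsub>M\<^esub>"]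
  by simp

lemma scalar_endo_closed:
  assumes "a \<in> ring_centre R"
  shows "scalar_endo M a \<in> carrier (End_ring R M)"
proof (rule End_ring_carrierI)
  fix b y assume ba: "b \<in> carrier R" "y \<in> carrier M"
  have "a \<odot>\<^bsub>M\<^esub> (b \<odot>\<^bsub>M\<^esub> y) = b \<odot>\<^bsub>M\<^esub> (a \<odot>\<^bsub>M\<^esub> y)"
    using assms ba by (simp add: ring_centre_def flip: smult_assoc1)
  then show "scalar_endo M a (b \<odot>\<^bsub>M\<^esub> y) = b \<odot>\<^bsub>M\<^esub> scalar_endo M a y"
    using ba by simp
qed (use assms in \<open>auto simp: ring_centre_def End_ring_extensional smult_r_distr\<close>)

lemma End_ring_ring: "ring (End_ring R M)"
proof (rule ringI)
  show "abelian_group (End_ring R M)"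
  proof (rule abelian_groupI)
    fix \<psi> assume \<psi>: "\<psi> \<in> carrier (End_ring R M)"
    note D = End_ring_carrierD[OF \<psi>]
    let ?\<chi> = "\<lambda>y \<in> carrier M. \<ominus>\<^bsub>M\<^esub> \<psi> y"
    have "?\<chi> \<in> carrier (End_ring R M)"
    proof (rule End_ring_carrierI)
      fix a y assume "a \<in> carrier R" "y \<in> carrier M"
      moreover have "\<ominus>\<^bsub>M\<^esub> (a \<odot>\<^bsub>M\<^esub> z) = a \<odot>\<^bsub>M\<^esub> (\<ominus>\<^bsub>M\<^esub> z)" if "a \<in> carrier R" "z \<in> carrier M" for a z
        using smult_r_distr[of a "\<ominus>\<^bsub>M\<^esub> z" z] that by (simp add: M.minus_equality M.l_neg)
      ultimately show "?\<chi> (a \<odot>\<^bsub>M\<^esub> y) = a \<odot>\<^bsub>M\<^esub> ?\<chi> y" using D by simp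
    qed (use D in \<open>auto simp: M.minus_add\<close>)
    moreover have "?\<chi> \<oplus>\<^bsub>End_ring R M\<^esub> \<psi> = \<zero>\<^bsub>End_ring R M\<^esub>"
      by (rule extensionalityI[OF End_ring_extensional(2,4)]) (use D in \<open>simp add: M.l_neg\<close>)
    ultimately show "\<exists>\<chi> \<in> carrier (End_ring R M). \<chi> \<oplus>\<^bsub>End_ring R M\<^esub> \<psi> = \<zero>\<^bsub>End_ring R M\<^esub>" by blast
  qed (auto intro!: End_ring_ext[of _ R M] End_ring_closed End_ring_const_closed
        simp: M.a_ac End_ring_carrierD)
  show "Group.monoid (End_ring R M)"
    by (rule Group.monoidI)
       (auto intro!: End_ring_ext[of _ R M] End_ring_closed End_ring_const_closed simp: End_ring_carrierD)
qed (auto intro!: End_ring_ext[of _ R M] End_ring_closed simp: End_ring_carrierD)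

lemma End_finsum_apply:
  assumes "g \<in> F \<rightarrow> carrier (End_ring R M)" "y \<in> carrier M"
  shows "finsum (End_ring R M) g F y = (\<Oplus>\<^bsub>M\<^esub>i\<in>F. g i y)"
  by (rule finsum_hom[of "End_ring R M" M "\<lambda>\<psi>. \<psi> y"])
     (use assms in \<open>auto simp: End_ring_carrierD End_ring_ring abelian_group.axioms ring.is_abelian_group
        M.abelian_monoid_axioms\<close>)

lemma End_apply_finsum:
  assumes \<psi>: "\<psi> \<in> carrier (End_ring R M)" and "g \<in> F \<rightarrow> carrier M"
  shows "\<psi> (finsum M g F) = (\<Oplus>\<^bsub>M\<^esub>i\<in>F. \<psi> (g i))"
  by (rule finsum_hom[of M M \<psi>])
     (use assms in \<open>auto simp: End_ring_carrierD[OF \<psi>] M.abelian_monoid_axioms\<close>)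

end

section \<open>Evaluation of noncommutative polynomials\<close>

lemma (in ring) centre_ring_ring: "ring (centre_ring R)"
proof -
  have "subring (ring_centre R) R"
  proof (rule subringI)
    fix h assume h: "h \<in> ring_centre R"
    then show "\<ominus> h \<in> ring_centre R"
      by (auto simp: ring_centre_def l_minus r_minus)
  next
    fix h1 h2 assume h: "h1 \<in> ring_centre R" "h2 \<in> ring_centre R"
    then have cl: "h1 \<in> carrier R" "h2 \<in> carrier R"
      and comm: "\<And>a. a \<in> carrier R \<Longrightarrow> h1 \<otimes> a = a \<otimes> h1" "\<And>a. a \<in> carrier R \<Longrightarrow> h2 \<otimes> a = a \<otimes> h2"
      by (auto simp: ring_centre_def)
    have "h1 \<otimes> h2 \<otimes> a = a \<otimes> (h1 \<otimes> h2)" if a: "a \<in> carrier R" for a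
    proof -
      have "h1 \<otimes> h2 \<otimes> a = h1 \<otimes> (h2 \<otimes> a)" using cl a by (intro m_assoc)
      also have "\<dots> = h1 \<otimes> (a \<otimes> h2)" unfolding comm(2)[OF a] ..
      also have "\<dots> = (h1 \<otimes> a) \<otimes> h2" using cl a by (intro m_assoc[symmetric])
      also have "\<dots> = a \<otimes> (h1 \<otimes> h2)" unfolding comm(1)[OF a] using cl a by (intro m_assoc)
      finally show ?thesis .
    qed
    then show "h1 \<otimes> h2 \<in> ring_centre R" using cl by (simp add: ring_centre_def)
    have "(h1 \<oplus> h2) \<otimes> a = a \<otimes> (h1 \<oplus> h2)" if a: "a \<in> carrier R" for a
      using cl a comm(1)[OF a] comm(2)[OF a] by (simp only: l_distr r_distr)
    then show "h1 \<oplus> h2 \<in> ring_centre R" using cl by (simp add: ring_centre_def)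
  qed (auto simp: ring_centre_def)
  then show ?thesis unfolding centre_ring_def by (rule subring_is_ring)
qed

lemma centre_ring_simps [simp]:
  "carrier (centre_ring R) = ring_centre R" "\<zero>\<^bsub>centre_ring R\<^esub> = \<zero>\<^bsub>R\<^esub>" "\<one>\<^bsub>centre_ring R\<^esub> = \<one>\<^bsub>R\<^esub>"
  "a \<otimes>\<^bsub>centre_ring R\<^esub> b = a \<otimes>\<^bsub>R\<^esub> b" "a \<oplus>\<^bsub>centre_ring R\<^esub> b = a \<oplus>\<^bsub>R\<^esub> b"
  by (simp_all add: centre_ring_def)

lemma (in ring) ordered_prod_closed:
  "set as \<subseteq> carrier R \<Longrightarrow> ordered_prod R as \<in> carrier R"
  by (induction as) (auto simp: ordered_prod_def)

lemma (in ring) ordered_prod_append: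
  "set as \<subseteq> carrier R \<Longrightarrow> set bs \<subseteq> carrier R \<Longrightarrow>
   ordered_prod R (as @ bs) = ordered_prod R as \<otimes> ordered_prod R bs"
proof (induction as)
  case Nil
  then show ?case using ordered_prod_closed[of bs] by (simp add: ordered_prod_def)
next
  case (Cons a as)
  then show ?case using ordered_prod_closed[of as] ordered_prod_closed[of bs]
    by (simp add: ordered_prod_def m_assoc)
qed

lemma nc_poly_carrierD:
  assumes "f \<in> carrier (nc_poly K r)"
  shows "f w \<in> carrier K" and "finite {w. f w \<noteq> \<zero>\<^bsub>K\<^esub>}" and "f w \<noteq> \<zero>\<^bsub>K\<^esub> \<Longrightarrow> set w \<subseteq> {1..r}"
  using assms by (auto simp: nc_poly_def)

lemma finite_splits: "finite {p. fst p @ snd p = (w :: 'x list)}"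
  and bij_betw_splits: "bij_betw (\<lambda>i. (take i w, drop i w)) {..length w} {p. fst p @ snd p = w}"
proof -
  show *: "bij_betw (\<lambda>i. (take i w, drop i w)) {..length w} {p. fst p @ snd p = w}"
    by (rule bij_betw_byWitness[where f' = "\<lambda>p. length (fst p)"]) auto
  show "finite {p. fst p @ snd p = w}"
    using bij_betw_finite[OF *] by simp
qed

text \<open>
  Coefficients must commute with the values substituted for the indeterminates, because the
  indeterminates commute with the coefficients in the polynomial ring; without that, evaluation is
  in general not multiplicative.
\<close>
locale central_algebra = K: ring K + A: ring A
  for K :: "('a, 'c) ring_scheme" and A :: "('e, 'd) ring_scheme" +
  fixes \<eta> :: "'a \<Rightarrow> 'e"
  assumes eta_hom: "\<eta> \<in> ring_hom K A"
    and eta_central: "\<lbrakk>c \<in> carrier K; a \<in> carrier A\<rbrakk> \<Longrightarrow> \<eta> c \<otimes>\<^bsub>A\<^esub> a = a \<otimes>\<^bsub>A\<^esub> \<eta> c"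
begin

lemma eta_simps [simp]:
  "c \<in> carrier K \<Longrightarrow> \<eta> c \<in> carrier A" "\<eta> \<one>\<^bsub>K\<^esub> = \<one>\<^bsub>A\<^esub>" "\<eta> \<zero>\<^bsub>K\<^esub> = \<zero>\<^bsub>A\<^esub>"
  "c \<in> carrier K \<Longrightarrow> d \<in> carrier K \<Longrightarrow> \<eta> (c \<otimes>\<^bsub>K\<^esub> d) = \<eta> c \<otimes>\<^bsub>A\<^esub> \<eta> d"
  "c \<in> carrier K \<Longrightarrow> d \<in> carrier K \<Longrightarrow> \<eta> (c \<oplus>\<^bsub>K\<^esub> d) = \<eta> c \<oplus>\<^bsub>A\<^esub> \<eta> d"
  using eta_hom ring_hom_zero[OF eta_hom K.ring_axioms A.ring_axioms]
  by (auto simp: ring_hom_closed ring_hom_one ring_hom_mult ring_hom_add)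

context
  fixes r :: nat and v :: "nat \<Rightarrow> 'e"
  assumes v: "\<And>j. j \<in> {1..r} \<Longrightarrow> v j \<in> carrier A"
begin

lemma word_closed:
  assumes "set w \<subseteq> {1..r}"
  shows "ordered_prod A (map v w) \<in> carrier A"
  by (rule A.ordered_prod_closed) (use v assms in auto)

lemma nc_term_closed:
  assumes "f \<in> carrier (nc_poly K r)" "set w \<subseteq> {1..r}"
  shows "\<eta> (f w) \<otimes>\<^bsub>A\<^esub> ordered_prod A (map v w) \<in> carrier A"
  using nc_poly_carrierD(1)[OF assms(1)] word_closed[OF assms(2)] by simp

lemma nc_eval_closed:
  assumes "f \<in> carrier (nc_poly K r)"
  shows "nc_eval K A \<eta> f v \<in> carrier A"
  unfolding nc_eval_def
  by (rule A.finsum_closed) (use nc_term_closed[OF assms] nc_poly_carrierD(3)[OF assms] in auto)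

lemma nc_eval_superset:
  assumes f: "f \<in> carrier (nc_poly K r)" and U: "finite U" "{w. f w \<noteq> \<zero>\<^bsub>K\<^esub>} \<subseteq> U" "\<And>w. w \<in> U \<Longrightarrow> set w \<subseteq> {1..r}"
  shows "nc_eval K A \<eta> f v = (\<Oplus>\<^bsub>A\<^esub>w\<in>U. \<eta> (f w) \<otimes>\<^bsub>A\<^esub> ordered_prod A (map v w))"
  unfolding nc_eval_def
  by (rule A.finsum_mono_neutral) (use U nc_term_closed[OF f] word_closed in auto)

lemma nc_poly_mult_closed:
  assumes f: "f \<in> carrier (nc_poly K r)" and g: "g \<in> carrier (nc_poly K r)"
  shows "f \<otimes>\<^bsub>nc_poly K r\<^esub> g \<in> carrier (nc_poly K r)"
    and "{w. (f \<otimes>\<^bsub>nc_poly K r\<^esub> g) w \<noteq> \<zero>\<^bsub>K\<^esub>} \<subseteq>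
      (\<lambda>(a, b). a @ b) ` ({w. f w \<noteq> \<zero>\<^bsub>K\<^esub>} \<times> {w. g w \<noteq> \<zero>\<^bsub>K\<^esub>})" (is "?supp \<subseteq> ?U")
proof -
  note fD = nc_poly_carrierD[OF f] and gD = nc_poly_carrierD[OF g]
  have mult: "(f \<otimes>\<^bsub>nc_poly K r\<^esub> g) w = (\<Oplus>\<^bsub>K\<^esub>i\<in>{..length w}. f (take i w) \<otimes>\<^bsub>K\<^esub> g (drop i w))" for w
    by (simp add: nc_poly_def)
  show sub: "?supp \<subseteq> ?U"
  proof
    fix w assume "w \<in> ?supp"
    then obtain i where "f (take i w) \<otimes>\<^bsub>K\<^esub> g (drop i w) \<noteq> \<zero>\<^bsub>K\<^esub>"
      using K.add.finprod_one_eqI[of "{..length w}" "\<lambda>i. f (take i w) \<otimes>\<^bsub>K\<^esub> g (drop i w)"]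
      by (auto simp: mult)
    then have "f (take i w) \<noteq> \<zero>\<^bsub>K\<^esub>" "g (drop i w) \<noteq> \<zero>\<^bsub>K\<^esub>"
      using fD(1) gD(1) by auto
    then show "w \<in> ?U" by (intro image_eqI[of _ _ "(take i w, drop i w)"]) auto
  qed
  have "(f \<otimes>\<^bsub>nc_poly K r\<^esub> g) w \<in> carrier K" for w
    unfolding mult using fD(1) gD(1) by (intro K.finsum_closed) auto
  moreover have "finite ?supp"
    by (rule finite_subset[OF sub]) (use fD(2) gD(2) in auto)
  moreover have "set w \<subseteq> {1..r}" if "(f \<otimes>\<^bsub>nc_poly K r\<^esub> g) w \<noteq> \<zero>\<^bsub>K\<^esub>" for w
  proof -
    have "w \<in> ?U" using that sub by blast
    then show ?thesis using fD(3) gD(3) by fastforce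
  qed
  ultimately show "f \<otimes>\<^bsub>nc_poly K r\<^esub> g \<in> carrier (nc_poly K r)"
    by (simp add: nc_poly_def)
qed

text \<open>
  Both sides are the sum of \<open>\<eta> (f a) v\<^sup>a \<eta> (g b) v\<^sup>b\<close> over all pairs of words \<open>(a, b)\<close> in the two
  supports; centrality of \<open>\<eta>\<close> moves the scalars together, and the pairs are grouped by the value
  of \<open>a @ b\<close>.
\<close>
lemma nc_eval_mult:
  assumes f: "f \<in> carrier (nc_poly K r)" and g: "g \<in> carrier (nc_poly K r)"
  shows "nc_eval K A \<eta> (f \<otimes>\<^bsub>nc_poly K r\<^esub> g) v = nc_eval K A \<eta> f v \<otimes>\<^bsub>A\<^esub> nc_eval K A \<eta> g v"
proof -
  note fD = nc_poly_carrierD[OF f] and gD = nc_poly_carrierD[OF g]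
  let ?S = "{w. f w \<noteq> \<zero>\<^bsub>K\<^esub>}" and ?T = "{w. g w \<noteq> \<zero>\<^bsub>K\<^esub>}"
  let ?W = "\<lambda>w. ordered_prod A (map v w)"
  define U where "U = (\<lambda>(a, b). a @ b) ` (?S \<times> ?T)"
  define h where "h p = \<eta> (f (fst p) \<otimes>\<^bsub>K\<^esub> g (snd p)) \<otimes>\<^bsub>A\<^esub> ?W (fst p @ snd p)" for p
  define P where "P w = {p \<in> ?S \<times> ?T. fst p @ snd p = w}" for w
  have finU: "finite U" using fD(2) gD(2) by (simp add: U_def)
  have wU: "set w \<subseteq> {1..r}" if "w \<in> U" for w
    using that fD(3) gD(3) unfolding U_def by fastforce
  have h_closed: "h p \<in> carrier A" if "fst p @ snd p \<in> U" for p
    unfolding h_def using word_closed[OF wU[OF that]] fD(1) gD(1) by (simp del: map_append)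
  have tf: "\<eta> (f w) \<otimes>\<^bsub>A\<^esub> ?W w \<in> carrier A" if "f w \<noteq> \<zero>\<^bsub>K\<^esub>" for w
    by (rule nc_term_closed[OF f fD(3)[OF that]])
  have tg: "\<eta> (g w) \<otimes>\<^bsub>A\<^esub> ?W w \<in> carrier A" if "g w \<noteq> \<zero>\<^bsub>K\<^esub>" for w
    by (rule nc_term_closed[OF g gD(3)[OF that]])
  have eg: "nc_eval K A \<eta> g v \<in> carrier A" by (rule nc_eval_closed[OF g])
  have PU: "fst p @ snd p \<in> U" if "p \<in> ?S \<times> ?T" for p
    using that unfolding U_def by force
  have "nc_eval K A \<eta> (f \<otimes>\<^bsub>nc_poly K r\<^esub> g) v =
      (\<Oplus>\<^bsub>A\<^esub>w\<in>U. \<eta> ((f \<otimes>\<^bsub>nc_poly K r\<^esub> g) w) \<otimes>\<^bsub>A\<^esub> ?W w)"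
    by (rule nc_eval_superset[OF nc_poly_mult_closed(1)[OF f g] finU _ wU])
       (use nc_poly_mult_closed(2)[OF f g] in \<open>simp_all only: U_def\<close>)
  also have "\<dots> = (\<Oplus>\<^bsub>A\<^esub>w\<in>U. finsum A h (P w))"
  proof (rule A.finsum_cong')
    fix w assume w: "w \<in> U"
    let ?t = "\<lambda>i. (take i w, drop i w)"
    have "\<eta> ((f \<otimes>\<^bsub>nc_poly K r\<^esub> g) w) = \<eta> (\<Oplus>\<^bsub>K\<^esub>i\<in>{..length w}. f (take i w) \<otimes>\<^bsub>K\<^esub> g (drop i w))"
      by (simp add: nc_poly_def)
    also have "\<dots> = (\<Oplus>\<^bsub>A\<^esub>i\<in>{..length w}. \<eta> (f (take i w) \<otimes>\<^bsub>K\<^esub> g (drop i w)))"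
      by (rule finsum_hom[of K A \<eta>])
         (use fD(1) gD(1) in \<open>auto simp: K.abelian_monoid_axioms A.abelian_monoid_axioms\<close>)
    finally have "\<eta> ((f \<otimes>\<^bsub>nc_poly K r\<^esub> g) w) \<otimes>\<^bsub>A\<^esub> ?W w =
        (\<Oplus>\<^bsub>A\<^esub>i\<in>{..length w}. \<eta> (f (take i w) \<otimes>\<^bsub>K\<^esub> g (drop i w)) \<otimes>\<^bsub>A\<^esub> ?W w)"
      using fD(1) gD(1) word_closed[OF wU[OF w]] by (simp add: A.finsum_ldistr)
    also have "\<dots> = (\<Oplus>\<^bsub>A\<^esub>i\<in>{..length w}. h (?t i))"
      by (simp add: h_def)
    also have "\<dots> = finsum A h (?t ` {..length w})"
      by (rule A.add.finprod_reindex[symmetric])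
         (use bij_betw_splits[of w] h_closed w in \<open>auto simp: bij_betw_def\<close>)
    also have "?t ` {..length w} = {p. fst p @ snd p = w}"
      using bij_betw_splits[of w] by (simp add: bij_betw_def)
    also have "finsum A h \<dots> = finsum A h (P w)"
    proof (rule A.finsum_mono_neutral[symmetric])
      show "h p = \<zero>\<^bsub>A\<^esub>" if "p \<in> {p. fst p @ snd p = w} - P w" for p
      proof -
        have "f (fst p) = \<zero>\<^bsub>K\<^esub> \<or> g (snd p) = \<zero>\<^bsub>K\<^esub>" using that by (cases p) (auto simp: P_def)
        then have "f (fst p) \<otimes>\<^bsub>K\<^esub> g (snd p) = \<zero>\<^bsub>K\<^esub>" using fD(1) gD(1) by auto
        then show ?thesis using word_closed[OF wU[OF w]] that by (simp add: h_def)
      qed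
    qed (use finite_splits h_closed w in \<open>auto simp: P_def\<close>)
    finally show "\<eta> ((f \<otimes>\<^bsub>nc_poly K r\<^esub> g) w) \<otimes>\<^bsub>A\<^esub> ?W w = finsum A h (P w)" .
  next
    show "(\<lambda>w. finsum A h (P w)) \<in> U \<rightarrow> carrier A"
      using h_closed by (auto intro!: A.finsum_closed simp: P_def)
  qed simp
  also have "\<dots> = finsum A h (\<Union>w\<in>U. P w)"
  proof (rule A.finsum_UN_disjoint[symmetric])
    show "finite (P w)" for w by (rule finite_subset[OF _ finite_splits[of w]]) (auto simp: P_def)
  qed (use finU h_closed in \<open>auto simp: P_def\<close>)
  also have "(\<Union>w\<in>U. P w) = (\<Union>a\<in>?S. Pair a ` ?T)"
    using PU by (simp only: P_def) blast
  also have "finsum A h \<dots> = (\<Oplus>\<^bsub>A\<^esub>a\<in>?S. finsum A h (Pair a ` ?T))"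
    by (rule A.finsum_UN_disjoint) (use fD(2) gD(2) h_closed PU in auto)
  also have "\<dots> = (\<Oplus>\<^bsub>A\<^esub>a\<in>?S. (\<eta> (f a) \<otimes>\<^bsub>A\<^esub> ?W a) \<otimes>\<^bsub>A\<^esub> nc_eval K A \<eta> g v)"
  proof (rule A.finsum_cong')
    fix a assume a: "a \<in> ?S"
    have "finsum A h (Pair a ` ?T) = (\<Oplus>\<^bsub>A\<^esub>b\<in>?T. h (a, b))"
      by (rule A.add.finprod_reindex)
         (use a PU h_closed in \<open>auto simp: inj_on_def\<close>)
    also have "\<dots> = (\<Oplus>\<^bsub>A\<^esub>b\<in>?T. (\<eta> (f a) \<otimes>\<^bsub>A\<^esub> ?W a) \<otimes>\<^bsub>A\<^esub> (\<eta> (g b) \<otimes>\<^bsub>A\<^esub> ?W b))"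
    proof (rule A.finsum_cong')
      fix b assume b: "b \<in> ?T"
      have cl: "\<eta> (f a) \<in> carrier A" "\<eta> (g b) \<in> carrier A" "?W a \<in> carrier A" "?W b \<in> carrier A"
        using a b fD gD word_closed by auto
      have "?W (a @ b) = ?W a \<otimes>\<^bsub>A\<^esub> ?W b"
      proof (subst map_append, rule A.ordered_prod_append)
        show "set (map v a) \<subseteq> carrier A" "set (map v b) \<subseteq> carrier A"
          using fD(3)[of a] gD(3)[of b] a b v by auto
      qed
      then have "h (a, b) = \<eta> (f a) \<otimes>\<^bsub>A\<^esub> (\<eta> (g b) \<otimes>\<^bsub>A\<^esub> ?W a) \<otimes>\<^bsub>A\<^esub> ?W b"
        using cl fD(1) gD(1) by (simp add: h_def A.m_assoc)
      also have "\<eta> (g b) \<otimes>\<^bsub>A\<^esub> ?W a = ?W a \<otimes>\<^bsub>A\<^esub> \<eta> (g b)"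
        using eta_central gD(1) cl by blast
      finally show "h (a, b) = (\<eta> (f a) \<otimes>\<^bsub>A\<^esub> ?W a) \<otimes>\<^bsub>A\<^esub> (\<eta> (g b) \<otimes>\<^bsub>A\<^esub> ?W b)"
        using cl by (simp add: A.m_assoc)
    qed (use a tf tg in simp_all)
    also have "\<dots> = (\<eta> (f a) \<otimes>\<^bsub>A\<^esub> ?W a) \<otimes>\<^bsub>A\<^esub> nc_eval K A \<eta> g v"
      unfolding nc_eval_def
      by (rule A.finsum_rdistr[symmetric]) (use a tf tg gD(2) in simp_all)
    finally show "finsum A h (Pair a ` ?T) = (\<eta> (f a) \<otimes>\<^bsub>A\<^esub> ?W a) \<otimes>\<^bsub>A\<^esub> nc_eval K A \<eta> g v" .
  qed (use tf eg in simp_all)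
  also have "\<dots> = nc_eval K A \<eta> f v \<otimes>\<^bsub>A\<^esub> nc_eval K A \<eta> g v"
    unfolding nc_eval_def[of _ _ _ f]
    by (rule A.finsum_ldistr[symmetric]) (use fD(2) tf eg in simp_all)
  finally show ?thesis .
qed

lemma nc_poly_one_closed: "\<one>\<^bsub>nc_poly K r\<^esub> \<in> carrier (nc_poly K r)"
  by (auto simp: nc_poly_def)

lemma nc_eval_one: "nc_eval K A \<eta> \<one>\<^bsub>nc_poly K r\<^esub> v = \<one>\<^bsub>A\<^esub>"
proof -
  have "nc_eval K A \<eta> \<one>\<^bsub>nc_poly K r\<^esub> v =
      (\<Oplus>\<^bsub>A\<^esub>w\<in>{[]}. \<eta> (\<one>\<^bsub>nc_poly K r\<^esub> w) \<otimes>\<^bsub>A\<^esub> ordered_prod A (map v w))"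
    by (rule nc_eval_superset[OF nc_poly_one_closed]) (auto simp: nc_poly_def)
  also have "\<dots> = \<one>\<^bsub>A\<^esub>"
    by (simp add: nc_poly_def ordered_prod_def)
  finally show ?thesis .
qed

lemma nc_eval_ordered_prod:
  assumes "set fs \<subseteq> carrier (nc_poly K r)"
  shows "nc_eval K A \<eta> (ordered_prod (nc_poly K r) fs) v =
    ordered_prod A (map (\<lambda>f. nc_eval K A \<eta> f v) fs)"
proof -
  have "ordered_prod (nc_poly K r) fs \<in> carrier (nc_poly K r) \<and> ?thesis"
    using assms
    by (induction fs)
       (auto simp: ordered_prod_def nc_poly_one_closed nc_eval_one nc_poly_mult_closed(1) nc_eval_mult)
  then show ?thesis ..
qed

end

end

lemma (in left_module) scalar_endo_central_algebra:
  "central_algebra (centre_ring R) (End_ring R M) (scalar_endo M)"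
proof -
  interpret E: ring "End_ring R M" by (rule End_ring_ring)
  interpret Z: ring "centre_ring R" by (rule R.centre_ring_ring)
  have RD: "z \<in> carrier R" if "z \<in> ring_centre R" for z
    using that by (simp add: ring_centre_def)
  show ?thesis
  proof unfold_locales
    show "scalar_endo M \<in> ring_hom (centre_ring R) (End_ring R M)"
    proof (rule ring_hom_memI)
      show "scalar_endo M z \<in> carrier (End_ring R M)" if "z \<in> carrier (centre_ring R)" for z
        using that by (simp add: scalar_endo_closed)
      show "scalar_endo M \<one>\<^bsub>centre_ring R\<^esub> = \<one>\<^bsub>End_ring R M\<^esub>"
        by (rule extensionalityI[OF End_ring_extensional(5,3)]) simp
    next
      fix z z' assume z: "z \<in> carrier (centre_ring R)" "z' \<in> carrier (centre_ring R)"
      show "scalar_endo M (z \<otimes>\<^bsub>centre_ring R\<^esub> z') = scalar_endo M z \<otimes>\<^bsub>End_ring R M\<^esub> scalar_endo M z'"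
        by (rule extensionalityI[OF End_ring_extensional(5,1)]) (use z RD in \<open>simp add: smult_assoc1\<close>)
      show "scalar_endo M (z \<oplus>\<^bsub>centre_ring R\<^esub> z') = scalar_endo M z \<oplus>\<^bsub>End_ring R M\<^esub> scalar_endo M z'"
        by (rule extensionalityI[OF End_ring_extensional(5,2)]) (use z RD in \<open>simp add: smult_l_distr\<close>)
    qed
  next
    fix z \<psi> assume "z \<in> carrier (centre_ring R)" and \<psi>: "\<psi> \<in> carrier (End_ring R M)"
    then show "scalar_endo M z \<otimes>\<^bsub>End_ring R M\<^esub> \<psi> = \<psi> \<otimes>\<^bsub>End_ring R M\<^esub> scalar_endo M z"
      by (intro extensionalityI[OF End_ring_extensional(1,1)]) (simp add: End_ring_carrierD[OF \<psi>] RD)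
  qed
qed

section \<open>Matrix rings and their opposites\<close>

lemma opposite_ring_simps [simp]:
  "carrier (opposite_ring A) = carrier A" "\<zero>\<^bsub>opposite_ring A\<^esub> = \<zero>\<^bsub>A\<^esub>" "\<one>\<^bsub>opposite_ring A\<^esub> = \<one>\<^bsub>A\<^esub>"
  "a \<otimes>\<^bsub>opposite_ring A\<^esub> b = b \<otimes>\<^bsub>A\<^esub> a" "finsum (opposite_ring A) = finsum A"
  by (simp_all add: opposite_ring_def finsum_def fun_eq_iff)

context ring
begin

lemma mat_carrier_apply [simp]:
  "A \<in> carrier (mat_ring m R) \<Longrightarrow> i \<in> {1..m} \<Longrightarrow> j \<in> {1..m} \<Longrightarrow> A (i, j) \<in> carrier R"
  by (auto simp: mat_ring_def PiE_def Pi_def)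

lemma mat_ext:
  assumes "A \<in> carrier (mat_ring m R)" "B \<in> carrier (mat_ring m R)"
    and "\<And>i j. i \<in> {1..m} \<Longrightarrow> j \<in> {1..m} \<Longrightarrow> A (i, j) = B (i, j)"
  shows "A = B"
proof (rule extensionalityI)
  show "A \<in> extensional ({1..m} \<times> {1..m})" "B \<in> extensional ({1..m} \<times> {1..m})"
    using assms(1,2) by (auto simp: mat_ring_def PiE_def)
qed (use assms(3) in auto)

lemma mat_carrierI:
  "(\<And>i j. i \<in> {1..m} \<Longrightarrow> j \<in> {1..m} \<Longrightarrow> a i j \<in> carrier R) \<Longrightarrow>
   (\<lambda>(i, j) \<in> {1..m} \<times> {1..m}. a i j) \<in> carrier (mat_ring m R)"
  by (auto simp: mat_ring_def PiE_def extensional_def)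

lemma mat_apply:
  assumes "i \<in> {1..m}" "j \<in> {1..m}"
  shows "(A \<otimes>\<^bsub>mat_ring m R\<^esub> B) (i, j) = (\<Oplus>l\<in>{1..m}. A (i, l) \<otimes> B (l, j))"
    and "(A \<oplus>\<^bsub>mat_ring m R\<^esub> B) (i, j) = A (i, j) \<oplus> B (i, j)"
    and "\<zero>\<^bsub>mat_ring m R\<^esub> (i, j) = \<zero>"
    and "scalar_mat m R s (i, j) = (if i = j then s else \<zero>)"
  using assms by (simp_all add: mat_ring_def scalar_mat_def)

lemma mat_one: "\<one>\<^bsub>mat_ring m R\<^esub> = scalar_mat m R \<one>"
  by (simp add: mat_ring_def scalar_mat_def)

lemma mat_closed:
  assumes "A \<in> carrier (mat_ring m R)" "B \<in> carrier (mat_ring m R)"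
  shows "A \<otimes>\<^bsub>mat_ring m R\<^esub> B \<in> carrier (mat_ring m R)"
    and "A \<oplus>\<^bsub>mat_ring m R\<^esub> B \<in> carrier (mat_ring m R)"
proof -
  have "A \<otimes>\<^bsub>mat_ring m R\<^esub> B = (\<lambda>(i, j) \<in> {1..m} \<times> {1..m}. \<Oplus>l\<in>{1..m}. A (i, l) \<otimes> B (l, j))"
    "A \<oplus>\<^bsub>mat_ring m R\<^esub> B = (\<lambda>(i, j) \<in> {1..m} \<times> {1..m}. A (i, j) \<oplus> B (i, j))"
    by (simp_all add: mat_ring_def)
  moreover have "(\<lambda>(i, j) \<in> {1..m} \<times> {1..m}. \<Oplus>l\<in>{1..m}. A (i, l) \<otimes> B (l, j)) \<in> carrier (mat_ring m R)"
    by (rule mat_carrierI, rule finsum_closed) (use assms in \<open>auto simp del: atLeastAtMost_iff\<close>)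
  moreover have "(\<lambda>(i, j) \<in> {1..m} \<times> {1..m}. A (i, j) \<oplus> B (i, j)) \<in> carrier (mat_ring m R)"
    by (rule mat_carrierI) (use assms in \<open>auto simp del: atLeastAtMost_iff\<close>)
  ultimately show "A \<otimes>\<^bsub>mat_ring m R\<^esub> B \<in> carrier (mat_ring m R)"
    "A \<oplus>\<^bsub>mat_ring m R\<^esub> B \<in> carrier (mat_ring m R)"
    by simp_all
qed

lemma mat_zero_closed: "\<zero>\<^bsub>mat_ring m R\<^esub> \<in> carrier (mat_ring m R)"
proof -
  have "\<zero>\<^bsub>mat_ring m R\<^esub> = (\<lambda>(i, j) \<in> {1..m} \<times> {1..m}. \<zero>)" by (simp add: mat_ring_def)
  also have "\<dots> \<in> carrier (mat_ring m R)" by (rule mat_carrierI) simp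
  finally show ?thesis .
qed

lemma scalar_mat_closed: "s \<in> carrier R \<Longrightarrow> scalar_mat m R s \<in> carrier (mat_ring m R)"
  unfolding scalar_mat_def by (rule mat_carrierI) auto

lemma mat_abelian_monoid: "abelian_monoid (mat_ring m R)"
  by (rule abelian_monoidI)
     (auto intro!: mat_ext[of _ m] mat_closed mat_zero_closed simp: mat_apply a_ac simp del: atLeastAtMost_iff)

lemma mat_scalar_mult_apply:
  assumes A: "A \<in> carrier (mat_ring m R)" and s: "s \<in> carrier R" and ij: "i \<in> {1..m}" "j \<in> {1..m}"
  shows "(A \<otimes>\<^bsub>mat_ring m R\<^esub> scalar_mat m R s) (i, j) = A (i, j) \<otimes> s"
    and "(scalar_mat m R s \<otimes>\<^bsub>mat_ring m R\<^esub> A) (i, j) = s \<otimes> A (i, j)"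
proof -
  have "(A \<otimes>\<^bsub>mat_ring m R\<^esub> scalar_mat m R s) (i, j) = (\<Oplus>l\<in>{1..m}. A (i, l) \<otimes> (if l = j then s else \<zero>))"
    unfolding mat_apply(1)[OF ij]
    by (rule finsum_cong') (use assms in \<open>auto simp: mat_apply simp del: atLeastAtMost_iff\<close>)
  also have "\<dots> = A (i, j) \<otimes> s"
    using assms by (subst finsum_eq_single[of _ j]) (auto simp del: atLeastAtMost_iff)
  finally show "(A \<otimes>\<^bsub>mat_ring m R\<^esub> scalar_mat m R s) (i, j) = A (i, j) \<otimes> s" .
  have "(scalar_mat m R s \<otimes>\<^bsub>mat_ring m R\<^esub> A) (i, j) = (\<Oplus>l\<in>{1..m}. (if i = l then s else \<zero>) \<otimes> A (l, j))"
    unfolding mat_apply(1)[OF ij]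
    by (rule finsum_cong') (use assms in \<open>auto simp: mat_apply simp del: atLeastAtMost_iff\<close>)
  also have "\<dots> = s \<otimes> A (i, j)"
    using assms by (subst finsum_eq_single[of _ i]) (auto simp del: atLeastAtMost_iff)
  finally show "(scalar_mat m R s \<otimes>\<^bsub>mat_ring m R\<^esub> A) (i, j) = s \<otimes> A (i, j)" .
qed

lemma mat_one_mult:
  assumes "A \<in> carrier (mat_ring m R)"
  shows "\<one>\<^bsub>mat_ring m R\<^esub> \<otimes>\<^bsub>mat_ring m R\<^esub> A = A"
  unfolding mat_one
  by (rule mat_ext[of _ m])
     (use assms in \<open>auto intro!: mat_closed scalar_mat_closed simp: mat_scalar_mult_apply simp del: atLeastAtMost_iff\<close>)

lemma mat_mult_zero:
  assumes "A \<in> carrier (mat_ring m R)"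
  shows "A \<otimes>\<^bsub>mat_ring m R\<^esub> \<zero>\<^bsub>mat_ring m R\<^esub> = \<zero>\<^bsub>mat_ring m R\<^esub>"
    and "\<zero>\<^bsub>mat_ring m R\<^esub> \<otimes>\<^bsub>mat_ring m R\<^esub> A = \<zero>\<^bsub>mat_ring m R\<^esub>"
proof -
  have "(A \<otimes>\<^bsub>mat_ring m R\<^esub> \<zero>\<^bsub>mat_ring m R\<^esub>) (i, j) = \<zero> \<and> (\<zero>\<^bsub>mat_ring m R\<^esub> \<otimes>\<^bsub>mat_ring m R\<^esub> A) (i, j) = \<zero>"
    if ij: "i \<in> {1..m}" "j \<in> {1..m}" for i j
    unfolding mat_apply(1)[OF ij]
    by (intro conjI add.finprod_one_eqI) (use assms ij in \<open>auto simp: mat_apply simp del: atLeastAtMost_iff\<close>)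
  then show "A \<otimes>\<^bsub>mat_ring m R\<^esub> \<zero>\<^bsub>mat_ring m R\<^esub> = \<zero>\<^bsub>mat_ring m R\<^esub>"
    "\<zero>\<^bsub>mat_ring m R\<^esub> \<otimes>\<^bsub>mat_ring m R\<^esub> A = \<zero>\<^bsub>mat_ring m R\<^esub>"
    using assms by (auto intro!: mat_ext[of _ m] mat_closed mat_zero_closed simp: mat_apply simp del: atLeastAtMost_iff)
qed

end

section \<open>The residue division ring\<close>

context ring
begin

definition residue :: "'a \<Rightarrow> 'a set" where
  "residue a = jacobson_radical R +> a"

abbreviation residue_ring :: "'a set ring" where
  "residue_ring \<equiv> R Quot jacobson_radical R"

lemma residue_ring_ring: "ring residue_ring"
  by (rule ideal.quotient_is_ring[OF jacobson_radical_ideal])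

lemma residue_hom: "residue \<in> ring_hom R residue_ring"
  using ideal.rcos_ring_hom[OF jacobson_radical_ideal] unfolding residue_def[abs_def] .

lemmas residue_simps =
  ring_hom_closed[OF residue_hom] ring_hom_mult[OF residue_hom] ring_hom_add[OF residue_hom]
  ring_hom_one[OF residue_hom] ring_hom_zero[OF residue_hom ring_axioms residue_ring_ring]

lemma residue_eq_zero_iff:
  assumes "a \<in> carrier R"
  shows "residue a = \<zero>\<^bsub>residue_ring\<^esub> \<longleftrightarrow> a \<in> jacobson_radical R"
proof -
  have "\<zero>\<^bsub>residue_ring\<^esub> = jacobson_radical R" by (simp only: FactRing_def ring.simps)
  then show ?thesis
    using ideal.rcos_const_imp_mem[OF jacobson_radical_ideal assms]
      abelian_subgroup.a_rcos_const[OF abelian_subgroupI3[OF ideal.axioms(1)[OF jacobson_radical_ideal] is_abelian_group]]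
    unfolding residue_def by metis
qed

lemma residue_ring_carrierE:
  assumes "B \<in> carrier residue_ring"
  obtains b where "b \<in> carrier R" "B = residue b"
  using Quot_carrierE[OF assms] unfolding residue_def by blast

lemma residue_eqI:
  assumes "a \<in> carrier R" "b \<in> carrier R" "a \<ominus> b \<in> jacobson_radical R"
  shows "residue a = residue b"
proof -
  interpret S: ring residue_ring by (rule residue_ring_ring)
  have "residue a = residue ((a \<ominus> b) \<oplus> b)"
    using assms by (simp add: a_minus_def a_assoc l_neg)
  also have "\<dots> = residue (a \<ominus> b) \<oplus>\<^bsub>residue_ring\<^esub> residue b"
    using assms by (simp only: residue_simps minus_closed)
  also have "residue (a \<ominus> b) = \<zero>\<^bsub>residue_ring\<^esub>"
    using assms residue_eq_zero_iff minus_closed by blast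
  finally show ?thesis using residue_simps(1)[OF assms(2)] by simp
qed

end

section \<open>Endomorphisms annihilating and annihilated by \<open>\<phi>\<close>\<close>

context left_module
begin

context
  fixes \<phi> assumes phi: "\<phi> \<in> carrier (End_ring R M)"
begin

lemma Cen0_iff:
  "\<psi> \<in> Cen0 R M \<phi> \<longleftrightarrow>
   \<psi> \<in> carrier (End_ring R M) \<and> (\<forall>y \<in> carrier M. \<psi> (\<phi> y) = \<zero>\<^bsub>M\<^esub> \<and> \<phi> (\<psi> y) = \<zero>\<^bsub>M\<^esub>)"
proof -
  have "\<chi> = \<zero>\<^bsub>End_ring R M\<^esub> \<longleftrightarrow> (\<forall>y \<in> carrier M. \<chi> y = \<zero>\<^bsub>M\<^esub>)"
    if "\<chi> \<in> carrier (End_ring R M)" for \<chi>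
    using End_ring_ext[OF that End_ring_const_closed(2)] by auto
  then have "\<psi> \<in> carrier (End_ring R M) \<Longrightarrow>
      \<psi> \<otimes>\<^bsub>End_ring R M\<^esub> \<phi> = \<zero>\<^bsub>End_ring R M\<^esub> \<longleftrightarrow> (\<forall>y \<in> carrier M. \<psi> (\<phi> y) = \<zero>\<^bsub>M\<^esub>)"
    "\<psi> \<in> carrier (End_ring R M) \<Longrightarrow>
      \<phi> \<otimes>\<^bsub>End_ring R M\<^esub> \<psi> = \<zero>\<^bsub>End_ring R M\<^esub> \<longleftrightarrow> (\<forall>y \<in> carrier M. \<phi> (\<psi> y) = \<zero>\<^bsub>M\<^esub>)"
    using End_ring_closed(1) phi by simp_all
  then show ?thesis unfolding Cen0_def by auto
qed

lemma Cen0_mult: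
  assumes "\<psi> \<in> Cen0 R M \<phi>" "\<chi> \<in> Cen0 R M \<phi>"
  shows "\<psi> \<otimes>\<^bsub>End_ring R M\<^esub> \<chi> \<in> Cen0 R M \<phi>"
  using assms End_ring_carrierD(1)[OF phi] by (auto simp: Cen0_iff End_ring_closed End_ring_carrierD(1))

lemma Cen0_scalar:
  assumes z: "z \<in> ring_centre R" and \<psi>: "\<psi> \<in> Cen0 R M \<phi>"
  shows "scalar_endo M z \<otimes>\<^bsub>End_ring R M\<^esub> \<psi> \<in> Cen0 R M \<phi>"
proof -
  have "z \<in> carrier R" using z by (simp add: ring_centre_def)
  then show ?thesis
    using assms End_ring_carrierD(1,3)[OF phi]
    by (auto simp: Cen0_iff End_ring_closed End_ring_carrierD(1) scalar_endo_closed)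
qed

lemma Cen0_finsum:
  assumes g: "\<And>i. i \<in> F \<Longrightarrow> g i \<in> Cen0 R M \<phi>"
  shows "finsum (End_ring R M) g F \<in> Cen0 R M \<phi>"
proof -
  interpret E: ring "End_ring R M" by (rule End_ring_ring)
  have gE: "g \<in> F \<rightarrow> carrier (End_ring R M)" using g by (auto simp: Cen0_def)
  have "finsum (End_ring R M) g F (\<phi> y) = \<zero>\<^bsub>M\<^esub> \<and> \<phi> (finsum (End_ring R M) g F y) = \<zero>\<^bsub>M\<^esub>"
    if y: "y \<in> carrier M" for y
  proof
    have "finsum (End_ring R M) g F (\<phi> y) = (\<Oplus>\<^bsub>M\<^esub>i\<in>F. g i (\<phi> y))"
      using End_finsum_apply[OF gE] End_ring_carrierD(1)[OF phi y] by simp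
    also have "\<dots> = \<zero>\<^bsub>M\<^esub>"
      by (rule M.add.finprod_one_eqI) (use g y in \<open>simp add: Cen0_iff\<close>)
    finally show "finsum (End_ring R M) g F (\<phi> y) = \<zero>\<^bsub>M\<^esub>" .
    have "\<phi> (finsum (End_ring R M) g F y) = \<phi> (\<Oplus>\<^bsub>M\<^esub>i\<in>F. g i y)"
      using End_finsum_apply[OF gE y] by simp
    also have "\<dots> = (\<Oplus>\<^bsub>M\<^esub>i\<in>F. \<phi> (g i y))"
      by (rule End_apply_finsum[OF phi]) (use gE y in \<open>auto intro: End_ring_carrierD(1)\<close>)
    also have "\<dots> = \<zero>\<^bsub>M\<^esub>"
      by (rule M.add.finprod_one_eqI) (use g y in \<open>simp add: Cen0_iff\<close>)
    finally show "\<phi> (finsum (End_ring R M) g F y) = \<zero>\<^bsub>M\<^esub>" .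
  qed
  then show ?thesis using E.finsum_closed[OF gE] by (simp add: Cen0_iff)
qed

end

end

section \<open>Coordinates with respect to a nilpotent Jordan normal base\<close>

locale jordan_base = left_module R M
  for R :: "('a, 'c) ring_scheme" (structure) and M :: "('a, 'b, 'm) module_scheme" (structure) +
  fixes \<phi> :: "'b \<Rightarrow> 'b" and m :: nat and k :: "nat \<Rightarrow> nat" and x :: "nat \<Rightarrow> nat \<Rightarrow> 'b"
  assumes local: "local_ring R"
    and phi: "\<phi> \<in> carrier (End_ring R M)"
    and base: "nilpotent_jordan_base R M \<phi> {1..m} k x"
begin

sublocale res: ring "R Quot jacobson_radical R"
  by (rule R.residue_ring_ring)

abbreviation S where "S \<equiv> R Quot jacobson_radical R"

definition idx :: "(nat \<times> nat) set" where
  "idx = (SIGMA \<gamma>:{1..m}. {1..k \<gamma>})"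

definition basis :: "nat \<times> nat \<Rightarrow> 'b" where
  "basis p = x (fst p) (snd p)"

definition comb :: "(nat \<times> nat \<Rightarrow> 'a) \<Rightarrow> 'b" where
  "comb a = (\<Oplus>\<^bsub>M\<^esub>p\<in>idx. a p \<odot>\<^bsub>M\<^esub> basis p)"

lemma finite_idx: "finite idx"
  by (simp add: idx_def)

lemma k_pos: "\<gamma> \<in> {1..m} \<Longrightarrow> 1 \<le> k \<gamma>"
  using base by (simp add: nilpotent_jordan_base_def)

lemma idx_iff: "(\<gamma>, i) \<in> idx \<longleftrightarrow> \<gamma> \<in> {1..m} \<and> 1 \<le> i \<and> i \<le> k \<gamma>"
  by (auto simp: idx_def)

lemma basis_closed [simp]: "p \<in> idx \<Longrightarrow> basis p \<in> carrier M"
  and basis_simple: "p \<in> idx \<Longrightarrow> simple_submodule (cyclic_submodule R M (basis p)) R M"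
  using base by (auto simp: nilpotent_jordan_base_def idx_def basis_def)

lemma phi_basis:
  assumes "(\<gamma>, i) \<in> idx"
  shows "\<phi> (basis (\<gamma>, i)) = (if i < k \<gamma> then basis (\<gamma>, i + 1) else \<zero>\<^bsub>M\<^esub>)"
proof (cases "i < k \<gamma>")
  case True
  then show ?thesis using base assms by (simp add: nilpotent_jordan_base_def idx_iff basis_def)
next
  case False
  then have "i = k \<gamma>" using assms by (simp add: idx_iff)
  then show ?thesis using base assms by (simp add: nilpotent_jordan_base_def idx_iff basis_def)
qed

lemma direct_sum: "internal_direct_sum R M idx (\<lambda>p. cyclic_submodule R M (basis p))"
proof -
  have "(\<lambda>(\<gamma>, i). cyclic_submodule R M (x \<gamma> i)) = (\<lambda>p. cyclic_submodule R M (basis p))"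
    by (auto simp: basis_def)
  then show ?thesis using base by (simp add: nilpotent_jordan_base_def idx_def)
qed

lemma decomposition:
  assumes "y \<in> carrier M"
  shows "\<exists>!c. c \<in> (\<Pi>\<^sub>E p \<in> idx. cyclic_submodule R M (basis p)) \<and> finite {p \<in> idx. c p \<noteq> \<zero>\<^bsub>M\<^esub>} \<and>
    y = (\<Oplus>\<^bsub>M\<^esub>p \<in> {p \<in> idx. c p \<noteq> \<zero>\<^bsub>M\<^esub>}. c p)"
  using direct_sum assms by (simp add: internal_direct_sum_def)

lemma support_sum:
  assumes "c \<in> idx \<rightarrow> carrier M"
  shows "(\<Oplus>\<^bsub>M\<^esub>p \<in> {p \<in> idx. c p \<noteq> \<zero>\<^bsub>M\<^esub>}. c p) = (\<Oplus>\<^bsub>M\<^esub>p \<in> idx. c p)"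
  by (rule M.finsum_mono_neutral) (use assms finite_idx in auto)

lemma comb_summands: "a \<in> idx \<rightarrow> carrier R \<Longrightarrow> (\<lambda>p. a p \<odot>\<^bsub>M\<^esub> basis p) \<in> idx \<rightarrow> carrier M"
  by (intro Pi_I smult_closed basis_closed) (rule Pi_mem)

lemma comb_closed [simp]: "a \<in> idx \<rightarrow> carrier R \<Longrightarrow> comb a \<in> carrier M"
  unfolding comb_def by (rule M.finsum_closed) (rule comb_summands)

lemma ex_comb:
  assumes "y \<in> carrier M"
  shows "\<exists>a \<in> idx \<rightarrow> carrier R. y = comb a"
proof -
  obtain c where c: "c \<in> (\<Pi>\<^sub>E p \<in> idx. cyclic_submodule R M (basis p))"
      and y: "y = (\<Oplus>\<^bsub>M\<^esub>p \<in> {p \<in> idx. c p \<noteq> \<zero>\<^bsub>M\<^esub>}. c p)"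
    using decomposition[OF assms] by blast
  have "\<forall>p \<in> idx. \<exists>a \<in> carrier R. c p = a \<odot>\<^bsub>M\<^esub> basis p"
    using c by (auto simp: PiE_def Pi_def cyclic_submodule_def)
  then obtain a where a: "\<And>p. p \<in> idx \<Longrightarrow> a p \<in> carrier R \<and> c p = a p \<odot>\<^bsub>M\<^esub> basis p" by metis
  have "y = (\<Oplus>\<^bsub>M\<^esub>p \<in> idx. c p)" unfolding y by (rule support_sum) (use a in auto)
  also have "\<dots> = comb a" unfolding comb_def by (rule M.finsum_cong') (use a in auto)
  finally show ?thesis using a by blast
qed

lemma annihilator_basis:
  assumes "p \<in> idx"
  shows "{a \<in> carrier R. a \<odot>\<^bsub>M\<^esub> basis p = \<zero>\<^bsub>M\<^esub>} = jacobson_radical R"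
  by (rule annihilator_simple_eq_jacobson_radical[OF local basis_closed[OF assms] basis_simple[OF assms]])

text \<open>
  Uniqueness in the direct sum determines the summands \<open>a\<^sub>p x\<^sub>p\<close> only, hence the coefficient \<open>a\<^sub>p\<close>
  up to the annihilator of \<open>x\<^sub>p\<close>, which is \<open>J\<close>.
\<close>
lemma comb_eq_imp_residue_eq:
  assumes a: "a \<in> idx \<rightarrow> carrier R" and a': "a' \<in> idx \<rightarrow> carrier R" and eq: "comb a = comb a'" and p: "p \<in> idx"
  shows "residue (a p) = residue (a' p)"
proof -
  let ?c = "\<lambda>a. \<lambda>p \<in> idx. a p \<odot>\<^bsub>M\<^esub> basis p"
  have c: "?c a \<in> (\<Pi>\<^sub>E p \<in> idx. cyclic_submodule R M (basis p)) \<and> finite {p \<in> idx. ?c a p \<noteq> \<zero>\<^bsub>M\<^esub>} \<and>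
      comb a = (\<Oplus>\<^bsub>M\<^esub>p \<in> {p \<in> idx. ?c a p \<noteq> \<zero>\<^bsub>M\<^esub>}. ?c a p)" if a: "a \<in> idx \<rightarrow> carrier R" for a
  proof (intro conjI)
    show "?c a \<in> (\<Pi>\<^sub>E p \<in> idx. cyclic_submodule R M (basis p))"
      using a by (auto simp: cyclic_submodule_def)
    show "finite {p \<in> idx. ?c a p \<noteq> \<zero>\<^bsub>M\<^esub>}" using finite_idx by simp
    have "(\<Oplus>\<^bsub>M\<^esub>p \<in> {p \<in> idx. ?c a p \<noteq> \<zero>\<^bsub>M\<^esub>}. ?c a p) = (\<Oplus>\<^bsub>M\<^esub>p \<in> idx. ?c a p)"
      by (rule support_sum) (use comb_summands[OF a] in \<open>simp add: Pi_iff\<close>)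
    also have "\<dots> = comb a"
      unfolding comb_def by (rule M.finsum_cong') (use comb_summands[OF a] in simp_all)
    finally show "comb a = (\<Oplus>\<^bsub>M\<^esub>p \<in> {p \<in> idx. ?c a p \<noteq> \<zero>\<^bsub>M\<^esub>}. ?c a p)" by simp
  qed
  note D = the1_equality[OF decomposition[OF comb_closed[OF a]]]
  have ceq: "?c a = ?c a'"
    by (rule trans[OF sym[OF D[OF c[OF a]]] D[OF c[OF a', folded eq]]])
  have eqp: "a p \<odot>\<^bsub>M\<^esub> basis p = a' p \<odot>\<^bsub>M\<^esub> basis p"
    using fun_cong[OF ceq, of p] p by simp
  have cl: "a p \<in> carrier R" "a' p \<in> carrier R" using a a' p by auto
  have "(a p \<ominus> a' p) \<odot>\<^bsub>M\<^esub> basis p = \<zero>\<^bsub>M\<^esub>"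
    using cl p eqp by (simp add: R.minus_eq smult_l_distr smult_minus M.r_neg)
  then have "a p \<ominus> a' p \<in> jacobson_radical R" using annihilator_basis[OF p] cl by blast
  then show ?thesis using R.residue_eqI cl by blast
qed

text \<open>Any expansion of \<open>y\<close> in the base may be chosen, as its coefficients are unique modulo \<open>J\<close>.\<close>
definition coord :: "nat \<times> nat \<Rightarrow> 'b \<Rightarrow> 'a set" where
  "coord p y = residue ((SOME a. a \<in> idx \<rightarrow> carrier R \<and> y = comb a) p)"

lemma coord_comb:
  assumes "a \<in> idx \<rightarrow> carrier R" "p \<in> idx"
  shows "coord p (comb a) = residue (a p)"
proof -
  let ?a = "SOME a'. a' \<in> idx \<rightarrow> carrier R \<and> comb a = comb a'"
  have a: "?a \<in> idx \<rightarrow> carrier R \<and> comb a = comb ?a" by (rule someI[of _ a]) (use assms in simp)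
  show ?thesis
    unfolding coord_def
    by (rule comb_eq_imp_residue_eq[OF conjunct1[OF a] assms(1) conjunct2[OF a, symmetric] assms(2)])
qed

lemma coord_closed [simp]:
  assumes "y \<in> carrier M" "p \<in> idx"
  shows "coord p y \<in> carrier S"
proof -
  obtain a where a: "a \<in> idx \<rightarrow> carrier R" "y = comb a" using ex_comb[OF assms(1)] by blast
  then show ?thesis using coord_comb[OF a(1) assms(2)] R.residue_simps(1) assms(2) by auto
qed

lemma coord_add:
  assumes "y \<in> carrier M" "z \<in> carrier M" "p \<in> idx"
  shows "coord p (y \<oplus>\<^bsub>M\<^esub> z) = coord p y \<oplus>\<^bsub>S\<^esub> coord p z"
proof -
  obtain a b where a: "a \<in> idx \<rightarrow> carrier R" "y = comb a" and b: "b \<in> idx \<rightarrow> carrier R" "z = comb b"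
    using ex_comb assms by metis
  have ab: "(\<lambda>p. a p \<oplus> b p) \<in> idx \<rightarrow> carrier R" using a b by auto
  have "y \<oplus>\<^bsub>M\<^esub> z = (\<Oplus>\<^bsub>M\<^esub>p\<in>idx. a p \<odot>\<^bsub>M\<^esub> basis p \<oplus>\<^bsub>M\<^esub> b p \<odot>\<^bsub>M\<^esub> basis p)"
    unfolding a b comb_def by (rule M.finsum_addf[symmetric]) (use comb_summands a b in auto)
  also have "\<dots> = comb (\<lambda>p. a p \<oplus> b p)"
    unfolding comb_def by (rule M.finsum_cong') (use a(1) b(1) in \<open>auto simp: smult_l_distr Pi_iff\<close>)
  finally have "coord p (y \<oplus>\<^bsub>M\<^esub> z) = residue (a p \<oplus> b p)" using coord_comb[OF ab assms(3)] by simp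
  also have "\<dots> = residue (a p) \<oplus>\<^bsub>S\<^esub> residue (b p)"
    by (rule R.residue_simps(3)) (use a b assms(3) in auto)
  finally show ?thesis using coord_comb a b assms(3) by simp
qed

lemma comb_smult:
  assumes a: "a \<in> idx \<rightarrow> carrier R" and s: "s \<in> carrier R"
  shows "s \<odot>\<^bsub>M\<^esub> comb a = comb (\<lambda>p. s \<otimes> a p)"
proof -
  have "s \<odot>\<^bsub>M\<^esub> comb a = (\<Oplus>\<^bsub>M\<^esub>p\<in>idx. s \<odot>\<^bsub>M\<^esub> (a p \<odot>\<^bsub>M\<^esub> basis p))"
    unfolding comb_def
    by (rule finsum_hom[of M M "\<lambda>y. s \<odot>\<^bsub>M\<^esub> y"])
       (use comb_summands[OF a] s in \<open>auto simp: smult_r_distr M.abelian_monoid_axioms\<close>)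
  also have "\<dots> = comb (\<lambda>p. s \<otimes> a p)"
    unfolding comb_def by (rule M.finsum_cong') (use a s in \<open>auto simp: smult_assoc1 Pi_iff\<close>)
  finally show ?thesis .
qed

lemma coord_smult:
  assumes y: "y \<in> carrier M" and s: "s \<in> carrier R" and p: "p \<in> idx"
  shows "coord p (s \<odot>\<^bsub>M\<^esub> y) = residue s \<otimes>\<^bsub>S\<^esub> coord p y"
proof -
  obtain a where a: "a \<in> idx \<rightarrow> carrier R" "y = comb a" using ex_comb[OF y] by blast
  have sa: "(\<lambda>p. s \<otimes> a p) \<in> idx \<rightarrow> carrier R" using a s by auto
  have "coord p (s \<odot>\<^bsub>M\<^esub> y) = residue (s \<otimes> a p)"
    unfolding a(2) comb_smult[OF a(1) s] by (rule coord_comb[OF sa p])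
  also have "\<dots> = residue s \<otimes>\<^bsub>S\<^esub> residue (a p)"
    by (rule R.residue_simps(2)) (use a s p in auto)
  finally show ?thesis using coord_comb[OF a(1) p] a(2) by simp
qed

lemma coord_zero [simp]: "p \<in> idx \<Longrightarrow> coord p \<zero>\<^bsub>M\<^esub> = \<zero>\<^bsub>S\<^esub>"
  using coord_smult[of "\<zero>\<^bsub>M\<^esub>" \<zero> p] coord_closed[of "\<zero>\<^bsub>M\<^esub>" p] by (simp add: R.residue_simps)

lemma coord_finsum:
  assumes "g \<in> F \<rightarrow> carrier M" "p \<in> idx"
  shows "coord p (finsum M g F) = (\<Oplus>\<^bsub>S\<^esub>i\<in>F. coord p (g i))"
  by (rule finsum_hom[of M S "coord p"])
     (use assms in \<open>auto simp: coord_add M.abelian_monoid_axioms res.abelian_monoid_axioms\<close>)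

lemma coord_basis:
  assumes "p \<in> idx" "q \<in> idx"
  shows "coord p (basis q) = (if p = q then \<one>\<^bsub>S\<^esub> else \<zero>\<^bsub>S\<^esub>)"
proof -
  let ?a = "\<lambda>p. if p = q then \<one> else \<zero>"
  have "comb ?a = ?a q \<odot>\<^bsub>M\<^esub> basis q"
    unfolding comb_def by (rule M.finsum_eq_single) (use assms finite_idx in auto)
  then have "coord p (basis q) = residue (?a p)"
    using coord_comb[of ?a p] assms by simp
  then show ?thesis by (simp add: R.residue_simps)
qed

lemma endo_comb:
  assumes \<psi>: "\<psi> \<in> carrier (End_ring R M)" and a: "a \<in> idx \<rightarrow> carrier R"
  shows "\<psi> (comb a) = (\<Oplus>\<^bsub>M\<^esub>p\<in>idx. a p \<odot>\<^bsub>M\<^esub> \<psi> (basis p))"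
proof -
  have "\<psi> (comb a) = (\<Oplus>\<^bsub>M\<^esub>p\<in>idx. \<psi> (a p \<odot>\<^bsub>M\<^esub> basis p))"
    unfolding comb_def by (rule End_apply_finsum[OF \<psi>]) (rule comb_summands[OF a])
  also have "\<dots> = (\<Oplus>\<^bsub>M\<^esub>p\<in>idx. a p \<odot>\<^bsub>M\<^esub> \<psi> (basis p))"
    by (rule M.finsum_cong') (use a End_ring_carrierD(1,3)[OF \<psi>] in \<open>auto simp: Pi_iff\<close>)
  finally show ?thesis .
qed

text \<open>The product of a row of coordinates with the matrix of \<open>\<psi>\<close>: scalars act from the left, so
  coefficients multiply in the order opposite to composition.\<close>
lemma coord_endo:
  assumes \<psi>: "\<psi> \<in> carrier (End_ring R M)" and y: "y \<in> carrier M" and q: "q \<in> idx"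
  shows "coord q (\<psi> y) = (\<Oplus>\<^bsub>S\<^esub>p\<in>idx. coord p y \<otimes>\<^bsub>S\<^esub> coord q (\<psi> (basis p)))"
proof -
  obtain a where a: "a \<in> idx \<rightarrow> carrier R" "y = comb a" using ex_comb[OF y] by blast
  note cl = End_ring_carrierD(1)[OF \<psi>]
  have "coord q (\<psi> y) = (\<Oplus>\<^bsub>S\<^esub>p\<in>idx. coord q (a p \<odot>\<^bsub>M\<^esub> \<psi> (basis p)))"
    unfolding a(2) endo_comb[OF \<psi> a(1)] by (rule coord_finsum[OF _ q]) (use a cl in auto)
  also have "\<dots> = (\<Oplus>\<^bsub>S\<^esub>p\<in>idx. coord p y \<otimes>\<^bsub>S\<^esub> coord q (\<psi> (basis p)))"
  proof (rule res.finsum_cong')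
    fix p assume p: "p \<in> idx"
    show "coord q (a p \<odot>\<^bsub>M\<^esub> \<psi> (basis p)) = coord p y \<otimes>\<^bsub>S\<^esub> coord q (\<psi> (basis p))"
      using coord_smult[of "\<psi> (basis p)" "a p" q] cl p q a(1) coord_comb[OF a(1) p] a(2) by auto
  qed (use y q cl in auto)
  finally show ?thesis .
qed

text \<open>
  \<open>\<phi>\<close> carries the first coordinate of a long chain to its second, so no first coordinate of a long
  chain survives in the kernel.
\<close>
lemma coord_ker_phi:
  assumes y: "y \<in> carrier M" "\<phi> y = \<zero>\<^bsub>M\<^esub>" and \<gamma>: "\<gamma> \<in> {1..m}" "2 \<le> k \<gamma>"
  shows "coord (\<gamma>, 1) y = \<zero>\<^bsub>S\<^esub>"
proof -
  have i1: "(\<gamma>, 1) \<in> idx" and i2: "(\<gamma>, 2) \<in> idx" using \<gamma> by (auto simp: idx_iff)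
  have shift: "coord (\<gamma>, 2) (\<phi> (basis p)) = (if p = (\<gamma>, 1) then \<one>\<^bsub>S\<^esub> else \<zero>\<^bsub>S\<^esub>)" if p: "p \<in> idx" for p
  proof -
    obtain \<delta> i where pi: "p = (\<delta>, i)" by (cases p)
    show ?thesis
    proof (cases "i < k \<delta>")
      case True
      then have "(\<delta>, i + 1) \<in> idx" using p pi by (auto simp: idx_iff)
      then show ?thesis using True phi_basis[of \<delta> i] p pi coord_basis[OF i2, of "(\<delta>, i + 1)"] by auto
    next
      case False
      then have "p \<noteq> (\<gamma>, 1)" using \<gamma> pi by auto
      then show ?thesis using False phi_basis[of \<delta> i] p pi i2 by auto
    qed
  qed
  have "\<zero>\<^bsub>S\<^esub> = coord (\<gamma>, 2) (\<phi> y)" using y i2 by simp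
  also have "\<dots> = (\<Oplus>\<^bsub>S\<^esub>p\<in>idx. coord p y \<otimes>\<^bsub>S\<^esub> coord (\<gamma>, 2) (\<phi> (basis p)))"
    by (rule coord_endo[OF phi y(1) i2])
  also have "\<dots> = coord (\<gamma>, 1) y \<otimes>\<^bsub>S\<^esub> coord (\<gamma>, 2) (\<phi> (basis (\<gamma>, 1)))"
    by (rule res.finsum_eq_single[OF finite_idx i1]) (use y i1 in \<open>auto simp: shift\<close>)
  also have "\<dots> = coord (\<gamma>, 1) y" using y i1 by (simp add: shift)
  finally show ?thesis by simp
qed

lemma Cen0D:
  assumes "\<psi> \<in> Cen0 R M \<phi>"
  shows "\<psi> \<in> carrier (End_ring R M)"
    and "y \<in> carrier M \<Longrightarrow> \<psi> y \<in> carrier M"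
    and "y \<in> carrier M \<Longrightarrow> \<psi> (\<phi> y) = \<zero>\<^bsub>M\<^esub>"
    and "y \<in> carrier M \<Longrightarrow> \<phi> (\<psi> y) = \<zero>\<^bsub>M\<^esub>"
  using assms End_ring_carrierD(1) unfolding Cen0_iff[OF phi] by auto

text \<open>Every base element that is not a head lies in the image of \<open>\<phi>\<close>.\<close>
lemma Cen0_basis:
  assumes "\<psi> \<in> Cen0 R M \<phi>" "(\<gamma>, i) \<in> idx" "i \<noteq> 1"
  shows "\<psi> (basis (\<gamma>, i)) = \<zero>\<^bsub>M\<^esub>"
proof -
  have i: "(\<gamma>, i - 1) \<in> idx" "i - 1 < k \<gamma>" "i - 1 + 1 = i" using assms(2,3) by (auto simp: idx_iff)
  then have "basis (\<gamma>, i) = \<phi> (basis (\<gamma>, i - 1))" using phi_basis[of \<gamma> "i - 1"] by simp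
  then show ?thesis using Cen0D(3)[OF assms(1)] i(1) by simp
qed

section \<open>The representation by matrices in \<open>\<W>(X)\<close>\<close>

text \<open>
  The full matrix of \<open>\<psi>\<close> in \<open>Cen\<^sub>0(\<phi>)\<close> would record the coordinates of \<open>\<psi>(x\<^sub>\<delta>\<^sub>,\<^sub>1)\<close> at the last element
  of every chain. Only the columns of chains of length 1, where last element and head coincide, are
  kept: they determine the same columns of every product, and the matrix then lies in \<open>\<W>(X)\<close>.
\<close>
definition rep :: "('b \<Rightarrow> 'b) \<Rightarrow> nat \<times> nat \<Rightarrow> 'a set" where
  "rep \<psi> = (\<lambda>(\<delta>, \<gamma>) \<in> {1..m} \<times> {1..m}. if k \<gamma> = 1 then coord (\<gamma>, 1) (\<psi> (basis (\<delta>, 1))) else \<zero>\<^bsub>S\<^esub>)"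

lemma head_idx [simp]: "\<gamma> \<in> {1..m} \<Longrightarrow> (\<gamma>, 1) \<in> idx"
  using k_pos by (simp add: idx_iff)

lemma rep_apply:
  "\<delta> \<in> {1..m} \<Longrightarrow> \<gamma> \<in> {1..m} \<Longrightarrow>
   rep \<psi> (\<delta>, \<gamma>) = (if k \<gamma> = 1 then coord (\<gamma>, 1) (\<psi> (basis (\<delta>, 1))) else \<zero>\<^bsub>S\<^esub>)"
  by (simp add: rep_def)

lemma rep_closed:
  assumes "\<psi> \<in> carrier (End_ring R M)"
  shows "rep \<psi> \<in> carrier (mat_ring m S)"
  unfolding rep_def
  by (rule res.mat_carrierI) (use End_ring_carrierD(1)[OF assms] head_idx in \<open>auto simp del: atLeastAtMost_iff One_nat_def\<close>)

lemma rep_W_ideal: "\<psi> \<in> carrier (End_ring R M) \<Longrightarrow> rep \<psi> \<in> W_ideal m S k"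
  unfolding W_ideal_def by (auto simp: rep_closed rep_apply simp del: atLeastAtMost_iff)

lemma rep_add:
  assumes "\<psi> \<in> carrier (End_ring R M)" "\<chi> \<in> carrier (End_ring R M)"
  shows "rep (\<psi> \<oplus>\<^bsub>End_ring R M\<^esub> \<chi>) = rep \<psi> \<oplus>\<^bsub>mat_ring m S\<^esub> rep \<chi>"
proof (rule res.mat_ext)
  fix \<delta> \<gamma> assume ij: "\<delta> \<in> {1..m}" "\<gamma> \<in> {1..m}"
  show "rep (\<psi> \<oplus>\<^bsub>End_ring R M\<^esub> \<chi>) (\<delta>, \<gamma>) = (rep \<psi> \<oplus>\<^bsub>mat_ring m S\<^esub> rep \<chi>) (\<delta>, \<gamma>)"
    using ij head_idx[OF ij(1)] head_idx[OF ij(2)] End_ring_carrierD(1)[OF assms(1)] End_ring_carrierD(1)[OF assms(2)]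
    by (simp add: rep_apply res.mat_apply coord_add del: atLeastAtMost_iff One_nat_def)
qed (use assms in \<open>auto intro!: rep_closed End_ring_closed res.mat_closed\<close>)

lemma rep_zero: "rep \<zero>\<^bsub>End_ring R M\<^esub> = \<zero>\<^bsub>mat_ring m S\<^esub>"
proof (rule res.mat_ext)
  fix \<delta> \<gamma> assume ij: "\<delta> \<in> {1..m}" "\<gamma> \<in> {1..m}"
  show "rep \<zero>\<^bsub>End_ring R M\<^esub> (\<delta>, \<gamma>) = \<zero>\<^bsub>mat_ring m S\<^esub> (\<delta>, \<gamma>)"
    using ij head_idx[OF ij(1)] head_idx[OF ij(2)]
    by (simp add: rep_apply res.mat_apply del: atLeastAtMost_iff One_nat_def)
qed (auto intro!: rep_closed End_ring_const_closed res.mat_zero_closed)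

text \<open>
  In the coordinate formula for \<open>\<psi>(\<chi>(x\<^sub>\<delta>\<^sub>,\<^sub>1))\<close> only the heads contribute, as \<open>\<psi>\<close> kills the other base
  elements. The coordinate of \<open>\<chi>(x\<^sub>\<delta>\<^sub>,\<^sub>1)\<close> at the head of a longer chain is zero because the value lies
  in the kernel of \<open>\<phi>\<close>; this matches the columns set to zero in \<open>rep \<chi>\<close>.
\<close>
lemma rep_mult:
  assumes \<psi>: "\<psi> \<in> Cen0 R M \<phi>" and \<chi>: "\<chi> \<in> Cen0 R M \<phi>"
  shows "rep (\<psi> \<otimes>\<^bsub>End_ring R M\<^esub> \<chi>) = rep \<chi> \<otimes>\<^bsub>mat_ring m S\<^esub> rep \<psi>"
proof (rule res.mat_ext)
  fix \<delta> \<gamma> assume ij: "\<delta> \<in> {1..m}" "\<gamma> \<in> {1..m}"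
  note cl = rep_closed[OF Cen0D(1)[OF \<psi>]] rep_closed[OF Cen0D(1)[OF \<chi>]]
  note [simp del] = atLeastAtMost_iff One_nat_def
  have xd: "basis (\<delta>, 1) \<in> carrier M" using ij by simp
  show "rep (\<psi> \<otimes>\<^bsub>End_ring R M\<^esub> \<chi>) (\<delta>, \<gamma>) = (rep \<chi> \<otimes>\<^bsub>mat_ring m S\<^esub> rep \<psi>) (\<delta>, \<gamma>)"
  proof (cases "k \<gamma> = 1")
    case False
    have "(\<Oplus>\<^bsub>S\<^esub>l\<in>{1..m}. rep \<chi> (\<delta>, l) \<otimes>\<^bsub>S\<^esub> rep \<psi> (l, \<gamma>)) = \<zero>\<^bsub>S\<^esub>"
    proof (rule res.add.finprod_one_eqI)
      fix l assume l: "l \<in> {1..m}"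
      then have "rep \<psi> (l, \<gamma>) = \<zero>\<^bsub>S\<^esub>" using False ij by (simp add: rep_apply)
      then show "rep \<chi> (\<delta>, l) \<otimes>\<^bsub>S\<^esub> rep \<psi> (l, \<gamma>) = \<zero>\<^bsub>S\<^esub>"
        using res.mat_carrier_apply[OF cl(2) ij(1) l] by simp
    qed
    then show ?thesis using False ij by (simp add: rep_apply res.mat_apply)
  next
    case True
    let ?y = "\<chi> (basis (\<delta>, 1))"
    let ?t = "\<lambda>p. coord p ?y \<otimes>\<^bsub>S\<^esub> coord (\<gamma>, 1) (\<psi> (basis p))"
    have y: "?y \<in> carrier M" "\<phi> ?y = \<zero>\<^bsub>M\<^esub>" using Cen0D[OF \<chi>] xd by auto
    have t: "?t p \<in> carrier S" if "p \<in> idx" for p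
      using that y ij Cen0D(2)[OF \<psi>] by simp
    have inj: "inj_on (\<lambda>l. (l, 1::nat)) {1..m}" by (simp add: inj_on_def)
    have "rep (\<psi> \<otimes>\<^bsub>End_ring R M\<^esub> \<chi>) (\<delta>, \<gamma>) = coord (\<gamma>, 1) (\<psi> ?y)"
      using True ij xd by (simp add: rep_apply)
    also have "\<dots> = finsum S ?t idx"
      by (rule coord_endo[OF Cen0D(1)[OF \<psi>] y(1)]) (use ij in simp)
    also have "\<dots> = finsum S ?t ((\<lambda>l. (l, 1)) ` {1..m})"
    proof (rule res.finsum_mono_neutral[symmetric, OF finite_idx])
      fix p assume p: "p \<in> idx - (\<lambda>l. (l, 1)) ` {1..m}"
      obtain l i where pi: "p = (l, i)" by (cases p)
      then have "i \<noteq> 1" using p by (auto simp: idx_iff)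
      then have "\<psi> (basis p) = \<zero>\<^bsub>M\<^esub>" using Cen0_basis[OF \<psi>, of l i] p pi by simp
      then show "?t p = \<zero>\<^bsub>S\<^esub>" using p y ij by simp
    qed (use t in auto)
    also have "\<dots> = (\<Oplus>\<^bsub>S\<^esub>l\<in>{1..m}. ?t (l, 1))"
      by (rule res.add.finprod_reindex[OF _ inj]) (use t in auto)
    also have "\<dots> = (\<Oplus>\<^bsub>S\<^esub>l\<in>{1..m}. rep \<chi> (\<delta>, l) \<otimes>\<^bsub>S\<^esub> rep \<psi> (l, \<gamma>))"
    proof (rule res.finsum_cong')
      fix l assume l: "l \<in> {1..m}"
      have "coord (l, 1) ?y = rep \<chi> (\<delta>, l)"
      proof (cases "k l = 1")
        case False
        then have "2 \<le> k l" using k_pos[OF l] by simp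
        then show ?thesis using False l ij coord_ker_phi[OF y l] by (simp add: rep_apply)
      qed (use l ij in \<open>simp add: rep_apply\<close>)
      then show "?t (l, 1) = rep \<chi> (\<delta>, l) \<otimes>\<^bsub>S\<^esub> rep \<psi> (l, \<gamma>)"
        using True l ij by (simp add: rep_apply)
    qed (use cl ij in auto)
    finally show ?thesis using ij by (simp add: res.mat_apply)
  qed
qed (use assms Cen0D(1) in \<open>auto intro!: rep_closed End_ring_closed res.mat_closed\<close>)

lemma rep_scalar:
  assumes z: "z \<in> ring_centre R" and \<psi>: "\<psi> \<in> carrier (End_ring R M)"
  shows "rep (scalar_endo M z \<otimes>\<^bsub>End_ring R M\<^esub> \<psi>) = rep \<psi> \<otimes>\<^bsub>mat_ring m S\<^esub> scalar_mat m S (residue z)"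
proof (rule res.mat_ext)
  have zR: "z \<in> carrier R" using z by (simp add: ring_centre_def)
  have central: "residue z \<otimes>\<^bsub>S\<^esub> B = B \<otimes>\<^bsub>S\<^esub> residue z" if B: "B \<in> carrier S" for B
  proof -
    obtain b where b: "b \<in> carrier R" "B = residue b" by (rule R.residue_ring_carrierE[OF B])
    have "z \<otimes> b = b \<otimes> z" using z b by (simp add: ring_centre_def)
    then show ?thesis using R.residue_simps(2)[OF zR b(1)] R.residue_simps(2)[OF b(1) zR] b(2) by simp
  qed
  fix \<delta> \<gamma> assume ij: "\<delta> \<in> {1..m}" "\<gamma> \<in> {1..m}"
  note [simp del] = atLeastAtMost_iff One_nat_def
  have y: "\<psi> (basis (\<delta>, 1)) \<in> carrier M" using End_ring_carrierD(1)[OF \<psi>] ij by simp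
  show "rep (scalar_endo M z \<otimes>\<^bsub>End_ring R M\<^esub> \<psi>) (\<delta>, \<gamma>) = (rep \<psi> \<otimes>\<^bsub>mat_ring m S\<^esub> scalar_mat m S (residue z)) (\<delta>, \<gamma>)"
    using ij y zR res.mat_scalar_mult_apply(1)[OF rep_closed[OF \<psi>] R.residue_simps(1)[OF zR] ij]
      R.residue_simps(1)[OF zR]
    by (auto simp: rep_apply coord_smult central)
next
  have zR: "z \<in> carrier R" using z by (simp add: ring_centre_def)
  show "rep (scalar_endo M z \<otimes>\<^bsub>End_ring R M\<^esub> \<psi>) \<in> carrier (mat_ring m S)"
    by (intro rep_closed End_ring_closed scalar_endo_closed z \<psi>)
  show "rep \<psi> \<otimes>\<^bsub>mat_ring m S\<^esub> scalar_mat m S (residue z) \<in> carrier (mat_ring m S)"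
    by (intro res.mat_closed rep_closed res.scalar_mat_closed R.residue_simps(1) zR \<psi>)
qed

text \<open>
  The empty word is excluded, since \<open>rep\<close> does not send the identity map to the identity matrix and
  the identity map is in general not in \<open>Cen\<^sub>0(\<phi>)\<close>.
\<close>
lemma rep_word:
  assumes "\<And>j. j \<in> set w \<Longrightarrow> v j \<in> Cen0 R M \<phi>" "w \<noteq> []"
  shows "ordered_prod (End_ring R M) (map v w) \<in> Cen0 R M \<phi>"
    and "rep (ordered_prod (End_ring R M) (map v w)) =
      ordered_prod (opposite_ring (mat_ring m S)) (map (\<lambda>j. rep (v j)) w)"
proof -
  interpret E: ring "End_ring R M" by (rule End_ring_ring)
  have "ordered_prod (End_ring R M) (map v w) \<in> Cen0 R M \<phi> \<and>
    rep (ordered_prod (End_ring R M) (map v w)) =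
      ordered_prod (opposite_ring (mat_ring m S)) (map (\<lambda>j. rep (v j)) w)"
    using assms(2,1)
  proof (induction w rule: list_nonempty_induct)
    case (single j)
    then show ?case
      using Cen0D(1)[of "v j"] by (simp add: ordered_prod_def res.mat_one_mult rep_closed)
  next
    case (cons j w)
    then show ?case
      using Cen0_mult[OF phi] rep_mult by (simp add: ordered_prod_def)
  qed
  then show "ordered_prod (End_ring R M) (map v w) \<in> Cen0 R M \<phi>"
    "rep (ordered_prod (End_ring R M) (map v w)) =
      ordered_prod (opposite_ring (mat_ring m S)) (map (\<lambda>j. rep (v j)) w)" by auto
qed

end

section \<open>Polynomial identities\<close>

context jordan_base
begin

text \<open>
  Evaluation at the zero matrix leaves the scalar matrix of the constant term, and for \<open>m \<ge> 1\<close> this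
  matrix shows its scalar.
\<close>
lemma constant_term_in_jacobson_radical:
  assumes m: "1 \<le> m" and f: "f \<in> carrier (nc_poly (centre_ring R) r)"
    and id: "nc_identity (centre_ring R) r (opposite_ring (mat_ring m S))
      (\<lambda>z. scalar_mat m S (residue z)) (W_ideal m S k) f"
  shows "f [] \<in> jacobson_radical R"
proof (rule ccontr)
  let ?A = "opposite_ring (mat_ring m S)"
  let ?Z = "\<zero>\<^bsub>mat_ring m S\<^esub>"
  let ?P = "\<lambda>w. ordered_prod ?A (map (\<lambda>j. ?Z) w)"
  let ?t = "\<lambda>w. scalar_mat m S (residue (f w)) \<otimes>\<^bsub>?A\<^esub> ?P w"
  interpret mat: abelian_monoid "mat_ring m S" by (rule res.mat_abelian_monoid)
  note fD = nc_poly_carrierD[OF f, simplified]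
  have fR: "f w \<in> carrier R" for w using fD(1)[of w] by (simp add: ring_centre_def)
  have sc: "scalar_mat m S (residue (f w)) \<in> carrier (mat_ring m S)" for w
    by (intro res.scalar_mat_closed R.residue_simps(1) fR)
  assume n: "f [] \<notin> jacobson_radical R"
  have J0: "\<zero> \<in> jacobson_radical R"
    using R.residue_eq_zero_iff[OF R.zero_closed] R.residue_simps(5) by simp
  have one: "\<one>\<^bsub>mat_ring m S\<^esub> \<in> carrier (mat_ring m S)"
    unfolding res.mat_one by (intro res.scalar_mat_closed) simp
  have P: "?P w \<in> carrier (mat_ring m S)" for w
    by (induction w) (auto simp: ordered_prod_def one intro: res.mat_closed res.mat_zero_closed)
  have "?Z \<in> W_ideal m S k"
    unfolding W_ideal_def
    using res.mat_zero_closed[of m] by (auto simp: res.mat_apply simp del: atLeastAtMost_iff)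
  then have "nc_eval (centre_ring R) ?A (\<lambda>z. scalar_mat m S (residue z)) f (\<lambda>j. ?Z) = ?Z"
    using id unfolding nc_identity_def by simp
  then have "?Z = finsum (mat_ring m S) ?t {w. f w \<noteq> \<zero>}"
    by (simp add: nc_eval_def)
  also have "\<dots> = ?t []"
  proof (rule mat.finsum_eq_single)
    show "[] \<in> {w. f w \<noteq> \<zero>}" using n J0 by auto
    fix w :: "nat list" assume "w \<noteq> []"
    then obtain j u where "w = j # u" by (cases w) auto
    then have "?P w = ?Z" using P[of u] res.mat_mult_zero(1) by (simp add: ordered_prod_def)
    then show "?t w = ?Z" using sc[of w] res.mat_mult_zero(2) by simp
  qed (use fD(2) sc[of "[]"] P[of "[]"] res.mat_closed(1) in auto)
  also have "\<dots> = scalar_mat m S (residue (f []))"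
    using sc res.mat_one_mult by (simp add: ordered_prod_def)
  finally have "?Z (1, 1) = scalar_mat m S (residue (f [])) (1, 1)" by simp
  then have "residue (f []) = \<zero>\<^bsub>S\<^esub>" using m by (simp add: res.mat_apply)
  then show False using n R.residue_eq_zero_iff[OF fR] by blast
qed

lemma jacobson_radical_annihilates:
  assumes a: "a \<in> jacobson_radical R" and y: "y \<in> carrier M"
  shows "a \<odot>\<^bsub>M\<^esub> y = \<zero>\<^bsub>M\<^esub>"
proof -
  have aR: "a \<in> carrier R" using a by (simp add: jacobson_radical_def)
  obtain c where c: "c \<in> idx \<rightarrow> carrier R" "y = comb c" using ex_comb[OF y] by blast
  have "a \<odot>\<^bsub>M\<^esub> y = (\<Oplus>\<^bsub>M\<^esub>p\<in>idx. (a \<otimes> c p) \<odot>\<^bsub>M\<^esub> basis p)"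
    using comb_smult[OF c(1) aR] c(2) by (simp add: comb_def)
  also have "\<dots> = \<zero>\<^bsub>M\<^esub>"
  proof (rule M.add.finprod_one_eqI)
    fix p assume p: "p \<in> idx"
    then have "a \<otimes> c p \<in> jacobson_radical R"
      using ideal.I_r_closed[OF R.jacobson_radical_ideal a] c(1) by auto
    then show "(a \<otimes> c p) \<odot>\<^bsub>M\<^esub> basis p = \<zero>\<^bsub>M\<^esub>" using annihilator_basis[OF p] by blast
  qed
  finally show ?thesis .
qed

text \<open>
  The summand of the empty word is zero on both sides by the hypothesis on the constant term; on the
  other summands \<open>rep\<close> is multiplicative.
\<close>
lemma rep_nc_eval:
  assumes v: "\<And>j. j \<in> {1..r} \<Longrightarrow> v j \<in> Cen0 R M \<phi>"
    and f: "f \<in> carrier (nc_poly (centre_ring R) r)" and const: "f [] \<in> jacobson_radical R"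
  shows "nc_eval (centre_ring R) (End_ring R M) (scalar_endo M) f v \<in> Cen0 R M \<phi>"
    and "rep (nc_eval (centre_ring R) (End_ring R M) (scalar_endo M) f v) =
      nc_eval (centre_ring R) (opposite_ring (mat_ring m S)) (\<lambda>z. scalar_mat m S (residue z)) f (\<lambda>j. rep (v j))"
proof -
  interpret E: ring "End_ring R M" by (rule End_ring_ring)
  let ?A = "opposite_ring (mat_ring m S)"
  let ?e = "\<lambda>w. scalar_endo M (f w) \<otimes>\<^bsub>End_ring R M\<^esub> ordered_prod (End_ring R M) (map v w)"
  let ?t = "\<lambda>w. scalar_mat m S (residue (f w)) \<otimes>\<^bsub>?A\<^esub> ordered_prod ?A (map (\<lambda>j. rep (v j)) w)"
  let ?supp = "{w. f w \<noteq> \<zero>}"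
  note fD = nc_poly_carrierD[OF f, simplified]
  have zero_Cen0: "\<zero>\<^bsub>End_ring R M\<^esub> \<in> Cen0 R M \<phi>"
    unfolding Cen0_iff[OF phi] using End_ring_const_closed(2) End_ring_carrierD(1)[OF phi] phi by simp
  have summand: "?e w \<in> Cen0 R M \<phi> \<and> rep (?e w) = ?t w" if "f w \<noteq> \<zero>" for w
  proof (cases "w = []")
    case True
    have one: "\<one>\<^bsub>mat_ring m S\<^esub> \<in> carrier (mat_ring m S)"
      unfolding res.mat_one by (intro res.scalar_mat_closed) simp
    have "scalar_endo M (f []) = \<zero>\<^bsub>End_ring R M\<^esub>"
      by (rule extensionalityI[OF End_ring_extensional(5,4)]) (simp add: jacobson_radical_annihilates[OF const])
    then have e: "?e w = \<zero>\<^bsub>End_ring R M\<^esub>" using True by (simp add: ordered_prod_def)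
    have "residue (f []) = \<zero>\<^bsub>S\<^esub>"
      using R.residue_eq_zero_iff const by (simp add: jacobson_radical_def)
    moreover have "scalar_mat m S \<zero>\<^bsub>S\<^esub> = \<zero>\<^bsub>mat_ring m S\<^esub>"
      by (auto simp: scalar_mat_def mat_ring_def fun_eq_iff)
    ultimately have "?t w = \<zero>\<^bsub>mat_ring m S\<^esub>"
      using True one res.mat_mult_zero(1) by (simp add: ordered_prod_def)
    then show ?thesis using e rep_zero zero_Cen0 by simp
  next
    case False
    have "v j \<in> Cen0 R M \<phi>" if "j \<in> set w" for j using v fD(3)[OF \<open>f w \<noteq> \<zero>\<close>] that by auto
    note W = rep_word[of w v, OF this False]
    show ?thesis
      using Cen0_scalar[OF phi fD(1) W(1)] rep_scalar[OF fD(1) Cen0D(1)[OF W(1)]] W(2) by simp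
  qed
  show "nc_eval (centre_ring R) (End_ring R M) (scalar_endo M) f v \<in> Cen0 R M \<phi>"
    unfolding nc_eval_def by (rule Cen0_finsum[OF phi]) (use summand in simp)
  have eE: "?e \<in> ?supp \<rightarrow> carrier (End_ring R M)" using summand Cen0D(1) by blast
  have "rep (finsum (End_ring R M) ?e ?supp) = finsum (mat_ring m S) (\<lambda>w. rep (?e w)) ?supp"
    by (rule finsum_hom[OF E.abelian_monoid_axioms res.mat_abelian_monoid])
       (use eE rep_closed rep_zero rep_add in auto)
  also have "\<dots> = finsum (mat_ring m S) ?t ?supp"
  proof (rule abelian_monoid.finsum_cong'[OF res.mat_abelian_monoid])
    show "?t \<in> ?supp \<rightarrow> carrier (mat_ring m S)"
    proof
      fix w assume "w \<in> ?supp"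
      then have "f w \<noteq> \<zero>" by simp
      from summand[OF this] show "?t w \<in> carrier (mat_ring m S)"
        using rep_closed[OF Cen0D(1)] by metis
    qed
  qed (use summand in simp_all)
  finally show "rep (nc_eval (centre_ring R) (End_ring R M) (scalar_endo M) f v) =
      nc_eval (centre_ring R) ?A (\<lambda>z. scalar_mat m S (residue z)) f (\<lambda>j. rep (v j))"
    unfolding nc_eval_def by simp
qed

text \<open>
  All values of \<open>\<psi>\<close> have zero coordinates at all heads: for chains of length 1 by \<open>rep \<psi> = 0\<close>, for
  longer ones because the values lie in the kernel of \<open>\<phi>\<close>. The remaining base elements are killed by
  \<open>\<chi>\<close>.
\<close>
lemma mult_eq_zero_of_rep_zero:
  assumes \<chi>: "\<chi> \<in> Cen0 R M \<phi>" and \<psi>: "\<psi> \<in> Cen0 R M \<phi>" and rep: "rep \<psi> = \<zero>\<^bsub>mat_ring m S\<^esub>"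
  shows "\<chi> \<otimes>\<^bsub>End_ring R M\<^esub> \<psi> = \<zero>\<^bsub>End_ring R M\<^esub>"
proof -
  have head: "coord (\<gamma>, 1) (\<psi> y) = \<zero>\<^bsub>S\<^esub>" if \<gamma>: "\<gamma> \<in> {1..m}" and y: "y \<in> carrier M" for \<gamma> y
  proof (cases "k \<gamma> = 1")
    case False
    then show ?thesis using coord_ker_phi[OF _ _ \<gamma>] k_pos[OF \<gamma>] Cen0D[OF \<psi>] y by simp
  next
    case True
    note gi = head_idx[OF \<gamma>]
    have "coord (\<gamma>, 1) (\<psi> y) = (\<Oplus>\<^bsub>S\<^esub>p\<in>idx. coord p y \<otimes>\<^bsub>S\<^esub> coord (\<gamma>, 1) (\<psi> (basis p)))"
      by (rule coord_endo[OF Cen0D(1)[OF \<psi>] y gi])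
    also have "\<dots> = \<zero>\<^bsub>S\<^esub>"
    proof (rule res.add.finprod_one_eqI)
      fix p assume p: "p \<in> idx"
      obtain \<delta> i where pi: "p = (\<delta>, i)" by (cases p)
      have "coord (\<gamma>, 1) (\<psi> (basis p)) = \<zero>\<^bsub>S\<^esub>"
      proof (cases "i = 1")
        case i: True
        have \<delta>: "\<delta> \<in> {1..m}" using p pi by (simp add: idx_iff)
        have "rep \<psi> (\<delta>, \<gamma>) = \<zero>\<^bsub>S\<^esub>" unfolding rep by (rule res.mat_apply(3)[OF \<delta> \<gamma>])
        then show ?thesis using rep_apply[OF \<delta> \<gamma>, of \<psi>] True i pi by simp
      next
        case False
        then show ?thesis using Cen0_basis[OF \<psi>] p pi gi by (metis coord_zero)
      qed
      then show "coord p y \<otimes>\<^bsub>S\<^esub> coord (\<gamma>, 1) (\<psi> (basis p)) = \<zero>\<^bsub>S\<^esub>" using y p by simp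
    qed
    finally show ?thesis .
  qed
  have "\<chi> (\<psi> y) = \<zero>\<^bsub>M\<^esub>" if y: "y \<in> carrier M" for y
  proof -
    obtain a where a: "a \<in> idx \<rightarrow> carrier R" "\<psi> y = comb a"
      using ex_comb[OF Cen0D(2)[OF \<psi> y]] by blast
    have "\<chi> (\<psi> y) = (\<Oplus>\<^bsub>M\<^esub>p\<in>idx. a p \<odot>\<^bsub>M\<^esub> \<chi> (basis p))"
      unfolding a(2) by (rule endo_comb[OF Cen0D(1)[OF \<chi>] a(1)])
    also have "\<dots> = \<zero>\<^bsub>M\<^esub>"
    proof (rule M.add.finprod_one_eqI)
      fix p assume p: "p \<in> idx"
      obtain \<gamma> i where pi: "p = (\<gamma>, i)" by (cases p)
      have ap: "a p \<in> carrier R" using a(1) p by (rule Pi_mem)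
      show "a p \<odot>\<^bsub>M\<^esub> \<chi> (basis p) = \<zero>\<^bsub>M\<^esub>"
      proof (cases "i = 1")
        case True
        have "\<gamma> \<in> {1..m}" using p pi by (simp add: idx_iff)
        then have "residue (a p) = \<zero>\<^bsub>S\<^esub>"
          using head[OF _ y, of \<gamma>] coord_comb[OF a(1) p] True pi a(2) by simp
        then have "a p \<in> jacobson_radical R" using R.residue_eq_zero_iff[OF ap] by simp
        then show ?thesis using jacobson_radical_annihilates Cen0D(2)[OF \<chi>] p by simp
      next
        case False
        then show ?thesis using Cen0_basis[OF \<chi>, of \<gamma> i] p pi ap by simp
      qed
    qed
    finally show ?thesis .
  qed
  then show ?thesis
    by (intro extensionalityI[OF End_ring_extensional(1,4)]) simp
qed

end

theorem theorem3p6: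
  fixes R :: "('a, 'c) ring_scheme" (structure)
    and M :: "('a, 'b, 'm) module_scheme"
    and \<phi> :: "'b \<Rightarrow> 'b"
    and x :: "nat \<Rightarrow> nat \<Rightarrow> 'b"
    and k :: "nat \<Rightarrow> nat"
    and m n r :: nat
    and f :: "nat \<Rightarrow> nat list \<Rightarrow> 'a"
  assumes "local_ring R"
    and "left_module R M"
    and "finitely_generated_module R M"
    and "semisimple_module R M"
    and "\<phi> \<in> carrier (End_ring R M)"
    and "nilpotent_of_index (End_ring R M) \<phi> n"
    and "nilpotent_jordan_base R M \<phi> {1..m} k x"
    and "\<And>\<gamma> \<delta>. 1 \<le> \<gamma> \<Longrightarrow> \<gamma> \<le> \<delta> \<Longrightarrow> \<delta> \<le> m \<Longrightarrow> k \<delta> \<le> k \<gamma>"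
    and "\<And>i. i \<in> {1..n} \<Longrightarrow> f i \<in> carrier (nc_poly (centre_ring R) r)"
    and "\<And>i. i \<in> {1..n} \<Longrightarrow>
           nc_identity (centre_ring R) r (opposite_ring (mat_ring m (R Quot jacobson_radical R)))
             (\<lambda>z. scalar_mat m (R Quot jacobson_radical R) (jacobson_radical R +> z))
             (W_ideal m (R Quot jacobson_radical R) k) (f i)"
  shows "nc_identity (centre_ring R) r (End_ring R M) (scalar_endo M) (Cen0 R M \<phi>)
           (ordered_prod (nc_poly (centre_ring R) r) (map f [1..<Suc n]))"
proof -
  interpret jordan_base R M \<phi> m k x
    using assms(1,2,5,7) by (simp add: jordan_base_def jordan_base_axioms_def)
  interpret E: ring "End_ring R M" by (rule End_ring_ring)
  interpret alg: central_algebra "centre_ring R" "End_ring R M" "scalar_endo M"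
    by (rule scalar_endo_central_algebra)
  have identities: "nc_identity (centre_ring R) r (opposite_ring (mat_ring m S))
      (\<lambda>z. scalar_mat m S (residue z)) (W_ideal m S k) (f i)" if "i \<in> {1..n}" for i
    using assms(10)[OF that] unfolding residue_def .
  have nil: "\<phi> [^]\<^bsub>End_ring R M\<^esub> n = \<zero>\<^bsub>End_ring R M\<^esub>"
    and small: "\<And>l. l < n \<Longrightarrow> \<phi> [^]\<^bsub>End_ring R M\<^esub> l \<noteq> \<zero>\<^bsub>End_ring R M\<^esub>"
    using assms(6) by (auto simp: nilpotent_of_index_def)
  show ?thesis
    unfolding nc_identity_def
  proof (intro allI impI)
    fix v assume "\<forall>j \<in> {1..r}. v j \<in> Cen0 R M \<phi>"
    then have v: "v j \<in> Cen0 R M \<phi>" if "j \<in> {1..r}" for j using that by blast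
    define \<psi> where "\<psi> i = nc_eval (centre_ring R) (End_ring R M) (scalar_endo M) (f i) v" for i
    have eval: "nc_eval (centre_ring R) (End_ring R M) (scalar_endo M)
        (ordered_prod (nc_poly (centre_ring R) r) (map f [1..<Suc n])) v =
        ordered_prod (End_ring R M) (map \<psi> [1..<Suc n])"
    proof -
      have "set (map f [1..<Suc n]) \<subseteq> carrier (nc_poly (centre_ring R) r)" using assms(9) by auto
      then show ?thesis
        by (subst alg.nc_eval_ordered_prod[of r v])
           (use v Cen0D(1) in \<open>simp_all add: \<psi>_def[abs_def] comp_def del: upt_Suc\<close>)
    qed
    have \<psi>: "\<psi> i \<in> Cen0 R M \<phi> \<and> rep (\<psi> i) = \<zero>\<^bsub>mat_ring m S\<^esub>" if i: "i \<in> {1..n}" for i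
    proof -
      have "1 \<le> m"
      proof (rule ccontr)
        \<comment> \<open>Otherwise \<open>M = 0\<close>, and then \<open>n = 0\<close> because the power \<open>\<phi>\<^sup>0\<close> is already zero.\<close>
        assume "\<not> 1 \<le> m"
        then have "idx = {}" by (simp add: idx_def)
        then have "y = \<zero>\<^bsub>M\<^esub>" if "y \<in> carrier M" for y
          using ex_comb[OF that] by (auto simp: comb_def)
        then have "\<one>\<^bsub>End_ring R M\<^esub> = \<zero>\<^bsub>End_ring R M\<^esub>"
          by (intro extensionalityI[OF End_ring_extensional(3,4)]) simp
        then show False using small[of 0] i by simp
      qed
      then have const: "f i [] \<in> jacobson_radical R"
        using constant_term_in_jacobson_radical assms(9) identities i by blast
      note ev = rep_nc_eval[OF v assms(9)[OF i] const]
      have "\<forall>j \<in> {1..r}. rep (v j) \<in> W_ideal m S k" using v Cen0D(1) rep_W_ideal by blast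
      then have "nc_eval (centre_ring R) (opposite_ring (mat_ring m S)) (\<lambda>z. scalar_mat m S (residue z))
          (f i) (\<lambda>j. rep (v j)) = \<zero>\<^bsub>mat_ring m S\<^esub>"
        using identities[OF i] unfolding nc_identity_def by simp
      then show ?thesis using ev by (simp add: \<psi>_def)
    qed
    have "ordered_prod (End_ring R M) (map \<psi> [1..<Suc n]) = \<zero>\<^bsub>End_ring R M\<^esub>"
    proof (cases "2 \<le> n")
      case True
      then have "[1..<Suc n] = 1 # 2 # [3..<Suc n]"
        by (simp add: upt_rec numeral_eq_Suc)
      then have "ordered_prod (End_ring R M) (map \<psi> [1..<Suc n]) =
          \<psi> 1 \<otimes>\<^bsub>End_ring R M\<^esub> (\<psi> 2 \<otimes>\<^bsub>End_ring R M\<^esub> ordered_prod (End_ring R M) (map \<psi> [3..<Suc n]))"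
        by (simp add: ordered_prod_def)
      moreover have "\<psi> 1 \<otimes>\<^bsub>End_ring R M\<^esub> \<psi> 2 = \<zero>\<^bsub>End_ring R M\<^esub>"
        using mult_eq_zero_of_rep_zero \<psi>[of 1] \<psi>[of 2] True by simp
      moreover have "ordered_prod (End_ring R M) (map \<psi> [3..<Suc n]) \<in> carrier (End_ring R M)"
        using \<psi> Cen0D(1) by (intro E.ordered_prod_closed) auto
      ultimately show ?thesis
        using \<psi>[of 1] \<psi>[of 2] Cen0D(1) True by (simp flip: E.m_assoc)
    next
      case False
      then consider "n = 0" | "n = 1" by linarith
      then show ?thesis
      proof cases
        case 1
        then show ?thesis using nil by (simp add: ordered_prod_def)
      next
        case 2
        \<comment> \<open>Here \<open>\<phi> = 0\<close>.\<close>
        have "\<one>\<^bsub>End_ring R M\<^esub> \<in> Cen0 R M \<phi>"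
          using nil phi 2 by (simp add: Cen0_def)
        then have "\<one>\<^bsub>End_ring R M\<^esub> \<otimes>\<^bsub>End_ring R M\<^esub> \<psi> 1 = \<zero>\<^bsub>End_ring R M\<^esub>"
          using mult_eq_zero_of_rep_zero \<psi>[of 1] 2 by simp
        then show ?thesis using \<psi>[of 1] Cen0D(1) 2 by (simp add: ordered_prod_def)
      qed
    qed
    then show "nc_eval (centre_ring R) (End_ring R M) (scalar_endo M)
        (ordered_prod (nc_poly (centre_ring R) r) (map f [1..<Suc n])) v = \<zero>\<^bsub>End_ring R M\<^esub>"
      using eval by simp
  qed
qed

end
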